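(* Let $\mathbf C,\mathbf D$ be strict monoidal categories with dually equivalent categories $\widehat{\mathbf C},\widehat{\mathbf D}$ (carrying the dual monoidal structures $\widehat\otimes$), and let $F\colon\mathbf D\to\mathbf C$ be left adjoint to a strong monoidal functor $U\colon\mathbf C\to\mathbf D$. Let $T=\widehat F\,\widehat U$ be the monad on $\widehat{\mathbf C}$ dual to the comonad $FU$ on $\mathbf C$, and let $J_T\colon\widehat{\mathbf C}\to\widehat{\mathbf C}_T$ be the canonical identity-on-objects functor into the Kleisli category of $T$. Then for all $k,n\in\mathbb N$ the category of $(k,n)$-ary $U$-operators is dually equivalent to the category of $(n,k)$-ary $J_T$-operators: $$\mathrm{Op}_U^{k,n}(\mathbf C)\;\simeq^{\mathrm{op}}\;\mathrm{Op}_{J_T}^{n,k}(\widehat{\mathbf C}).$$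
   Context: Duals: the contravariant functors witnessing $\mathbf C\simeq^{\mathrm{op}}\widehat{\mathbf C}$ (and likewise for $\mathbf D$) are both written $\widehat{(-)}$; the dual of a functor $G$ is $\widehat G=\widehat{(-)}\cdot G\cdot\widehat{(-)}$. The tensor $\widehat\otimes$ on $\widehat{\mathbf C}$, $\widehat{\mathbf D}$ is the dual of $\otimes$. Let $\eta,\varepsilon$ be the unit and counit of $F\dashv U$ and $\lambda\colon UX\otimes UY\cong U(X\otimes Y)$, $\epsilon\colon I_{\mathbf D}\cong UI_{\mathbf C}$ the strong monoidal structure of $U$. The monad $T=\widehat F\widehat U$ has unit $\hat\varepsilon$ and multiplication $\widehat F\hat\eta\widehat U$. Monoidal Kleisli category: $\widehat U$ is a strong monoidal left adjoint of $\widehat F$, so $\widehat F$ is lax monoidal and $T$ is a monoidal monad with structure $\hat\delta\colon TX\,\widehat\otimes\, TY\to T(X\,\widehat\otimes\, Y)$. Hence $\widehat{\mathbf C}_T$ is monoidal: on objects the tensor is $\widehat\otimes$, and the tensor of Kleisli morphisms $f\colon X\to TY$, $g\colon X'\to TY'$ is $\hat\delta\cdot(f\,\widehat\otimes\, g)$. The functor $J_T$ sends $f\colon A\to B$ to $A\to B\to TB$ (composition with the monad unit). Operators: for a functor $G\colon\mathbf A\to\mathbf B$ between monoidal categories, a $(k,n)$-ary $G$-operator is an object $A\in\mathbf A$ together with a morphism $a\colon(GA)^{\otimes k}\to(GA)^{\otimes n}$ of $\mathbf B$. A morphism $(A,a)\to(B,b)$ of $(k,n)$-ary $G$-operators is a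 morphism $h\colon GA\to GB$ of $\mathbf B$ with $h^{\otimes n}\cdot a=b\cdot h^{\otimes k}$. These form the category $\mathrm{Op}_G^{k,n}(\mathbf A)$. *)

theory Defs
  imports Main
begin

section \<open>Categories\<close>

record ('o, 'a) cat =
  Obj :: "'o set"
  Arr :: "'a set"
  Dom :: "'a \<Rightarrow> 'o"
  Cod :: "'a \<Rightarrow> 'o"
  Ide :: "'o \<Rightarrow> 'a"
  Comp :: "'a \<Rightarrow> 'a \<Rightarrow> 'a"  (infixr "\<cdot>\<index>" 70)

definition Hom :: "('o, 'a, 'm) cat_scheme \<Rightarrow> 'o \<Rightarrow> 'o \<Rightarrow> 'a set" where
  "Hom C X Y = {f \<in> Arr C. Dom C f = X \<and> Cod C f = Y}"

locale category =
  fixes C :: "('o, 'a, 'm) cat_scheme" (structure)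
  assumes Dom_in: "f \<in> Arr C \<Longrightarrow> Dom C f \<in> Obj C"
    and Cod_in: "f \<in> Arr C \<Longrightarrow> Cod C f \<in> Obj C"
    and Ide_in: "X \<in> Obj C \<Longrightarrow> Ide C X \<in> Hom C X X"
    and Comp_in: "\<lbrakk>f \<in> Hom C X Y; g \<in> Hom C Y Z\<rbrakk> \<Longrightarrow> g \<cdot> f \<in> Hom C X Z"
    and Comp_Ide: "f \<in> Hom C X Y \<Longrightarrow> f \<cdot> Ide C X = f"
    and Ide_Comp: "f \<in> Hom C X Y \<Longrightarrow> Ide C Y \<cdot> f = f"
    and Comp_assoc: "\<lbrakk>f \<in> Hom C W X; g \<in> Hom C X Y; h \<in> Hom C Y Z\<rbrakk>
      \<Longrightarrow> (h \<cdot> g) \<cdot> f = h \<cdot> (g \<cdot> f)"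

definition op_cat :: "('o, 'a, 'm) cat_scheme \<Rightarrow> ('o, 'a, 'm) cat_scheme" where
  "op_cat C = C\<lparr>Dom := Cod C, Cod := Dom C, Comp := (\<lambda>g f. f \<cdot>\<^bsub>C\<^esub> g)\<rparr>"

definition inverse_arrows :: "('o, 'a, 'm) cat_scheme \<Rightarrow> 'a \<Rightarrow> 'a \<Rightarrow> bool" where
  "inverse_arrows C f g \<longleftrightarrow>
     f \<in> Arr C \<and> g \<in> Hom C (Cod C f) (Dom C f) \<and>
     g \<cdot>\<^bsub>C\<^esub> f = Ide C (Dom C f) \<and> f \<cdot>\<^bsub>C\<^esub> g = Ide C (Cod C f)"

definition iso :: "('o, 'a, 'm) cat_scheme \<Rightarrow> 'a \<Rightarrow> bool" where
  "iso C f \<longleftrightarrow> (\<exists>g. inverse_arrows C f g)"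

definition inv_arr :: "('o, 'a, 'm) cat_scheme \<Rightarrow> 'a \<Rightarrow> 'a" where
  "inv_arr C f = (THE g. inverse_arrows C f g)"

record ('o, 'a, 'p, 'b) fun_data =
  ob :: "'o \<Rightarrow> 'p"
  ar :: "'a \<Rightarrow> 'b"

definition fun_id :: "('o, 'a, 'o, 'a) fun_data" where
  "fun_id = \<lparr>ob = (\<lambda>X. X), ar = (\<lambda>f. f)\<rparr>"

definition fun_comp ::
  "('p, 'b, 'q, 'c) fun_data \<Rightarrow> ('o, 'a, 'p, 'b) fun_data \<Rightarrow> ('o, 'a, 'q, 'c) fun_data"
  (infixr "\<circ>\<^sub>F" 55) where
  "G \<circ>\<^sub>F F = \<lparr>ob = (\<lambda>X. ob G (ob F X)), ar = (\<lambda>f. ar G (ar F f))\<rparr>"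

locale is_functor = A: category A + B: category B
  for A :: "('o, 'a, 'm) cat_scheme" and B :: "('p, 'b, 'n) cat_scheme" +
  fixes F :: "('o, 'a, 'p, 'b) fun_data"
  assumes ob_in: "X \<in> Obj A \<Longrightarrow> ob F X \<in> Obj B"
    and ar_in: "f \<in> Hom A X Y \<Longrightarrow> ar F f \<in> Hom B (ob F X) (ob F Y)"
    and ar_Ide: "X \<in> Obj A \<Longrightarrow> ar F (Ide A X) = Ide B (ob F X)"
    and ar_Comp: "\<lbrakk>f \<in> Hom A X Y; g \<in> Hom A Y Z\<rbrakk>
      \<Longrightarrow> ar F (g \<cdot>\<^bsub>A\<^esub> f) = ar F g \<cdot>\<^bsub>B\<^esub> ar F f"

locale nat_trans = F: is_functor A B F + G: is_functor A B G
  for A :: "('o, 'a, 'm) cat_scheme" and B :: "('p, 'b, 'n) cat_scheme"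
    and F G :: "('o, 'a, 'p, 'b) fun_data" +
  fixes \<tau> :: "'o \<Rightarrow> 'b"
  assumes component_in: "X \<in> Obj A \<Longrightarrow> \<tau> X \<in> Hom B (ob F X) (ob G X)"
    and naturality: "f \<in> Hom A X Y \<Longrightarrow> \<tau> Y \<cdot>\<^bsub>B\<^esub> ar F f = ar G f \<cdot>\<^bsub>B\<^esub> \<tau> X"

locale nat_iso = nat_trans +
  assumes component_iso: "X \<in> Obj A \<Longrightarrow> iso B (\<tau> X)"

locale adjunction =
  \<eta>: nat_trans A A fun_id "R \<circ>\<^sub>F L" \<eta> + \<epsilon>: nat_trans B B "L \<circ>\<^sub>F R" fun_id \<epsilon>
  + L: is_functor A B L + R: is_functor B A R
  for A :: "('o, 'a, 'm) cat_scheme" and B :: "('p, 'b, 'n) cat_scheme"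
    and L :: "('o, 'a, 'p, 'b) fun_data" and R :: "('p, 'b, 'o, 'a) fun_data"
    and \<eta> :: "'o \<Rightarrow> 'a" and \<epsilon> :: "'p \<Rightarrow> 'b" +
  assumes triangle_L: "X \<in> Obj A \<Longrightarrow> \<epsilon> (ob L X) \<cdot>\<^bsub>B\<^esub> ar L (\<eta> X) = Ide B (ob L X)"
    and triangle_R: "Y \<in> Obj B \<Longrightarrow> ar R (\<epsilon> Y) \<cdot>\<^bsub>A\<^esub> \<eta> (ob R Y) = Ide A (ob R Y)"


section \<open>Dual equivalences\<close>

text \<open>
  The two contravariant functors of a dual equivalence between a category \<open>C\<close> and its dual
  are \<open>hat\<close> (from \<open>C\<close>) and \<open>cohat\<close> (to \<open>C\<close>).  Contravariant functors are functors on the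
  opposite of their source; composites of two of them are covariant.
\<close>

record ('o, 'a, 'p, 'b) dual_data =
  hat :: "('o, 'a, 'p, 'b) fun_data"
  cohat :: "('p, 'b, 'o, 'a) fun_data"
  hat_iso :: "'p \<Rightarrow> 'b"
  cohat_iso :: "'o \<Rightarrow> 'a"

locale dual_equivalence =
  hat: is_functor "op_cat C" C' "hat d" + cohat: is_functor "op_cat C'" C "cohat d"
  + hat_iso: nat_iso C' C' fun_id "hat d \<circ>\<^sub>F cohat d" "hat_iso d"
  + cohat_iso: nat_iso C C fun_id "cohat d \<circ>\<^sub>F hat d" "cohat_iso d"
  for C :: "('o, 'a, 'm) cat_scheme" and C' :: "('p, 'b, 'n) cat_scheme"
    and d :: "('o, 'a, 'p, 'b) dual_data"

definition dually_equivalent ::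
  "('o, 'a, 'm) cat_scheme \<Rightarrow> ('p, 'b, 'n) cat_scheme \<Rightarrow> bool" where
  "dually_equivalent C C' \<longleftrightarrow> (\<exists>d. dual_equivalence C C' d)"

text \<open>
  The triangle identities fix how the two natural isomorphisms of a dual equivalence match.
  Without them the unit and multiplication below do not satisfy the monad laws; they cost no
  generality, as \<open>cohat_iso\<close> can always be replaced so that they hold (lemma
  \<open>dual_equivalence_adjoint\<close> below).
\<close>

locale dual_adjoint_equivalence = dual_equivalence +
  assumes triangle_hat: "Y \<in> Obj C \<Longrightarrow>
      ar (hat d) (cohat_iso d Y) \<cdot>\<^bsub>C'\<^esub> hat_iso d (ob (hat d) Y) = Ide C' (ob (hat d) Y)"
    and triangle_cohat: "X \<in> Obj C' \<Longrightarrow>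
      ar (cohat d) (hat_iso d X) \<cdot>\<^bsub>C\<^esub> cohat_iso d (ob (cohat d) X) = Ide C (ob (cohat d) X)"


lemma Hom_op_cat: "Hom (op_cat C) X Y = Hom C Y X"
  by (auto simp: Hom_def op_cat_def)

lemma op_cat_simps:
  "Obj (op_cat C) = Obj C" "Ide (op_cat C) = Ide C" "g \<cdot>\<^bsub>op_cat C\<^esub> f = f \<cdot>\<^bsub>C\<^esub> g"
  by (auto simp: op_cat_def)

lemma (in dual_equivalence) dual_equivalence_adjoint:
  "\<exists>\<beta>. dual_adjoint_equivalence C C' (d\<lparr>cohat_iso := \<beta>\<rparr>)"
proof -
  define P where "P = hat d"
  define Q where "Q = cohat d"
  define a where "a = hat_iso d"
  define b where "b = cohat_iso d"
  note defs = P_def Q_def a_def b_def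
  have HD: "X \<in> Obj C \<and> Y \<in> Obj C" if "f \<in> Hom C X Y" for f X Y
    using that cohat.B.Dom_in cohat.B.Cod_in by (auto simp: Hom_def)
  have HD': "X \<in> Obj C' \<and> Y \<in> Obj C'" if "f \<in> Hom C' X Y" for f X Y
    using that hat.B.Dom_in hat.B.Cod_in by (auto simp: Hom_def)
  have Po [intro]: "ob P X \<in> Obj C'" if "X \<in> Obj C" for X
    using hat.ob_in that by (auto simp: op_cat_simps defs)
  have Qo [intro]: "ob Q X \<in> Obj C" if "X \<in> Obj C'" for X
    using cohat.ob_in that by (auto simp: op_cat_simps defs)
  have Pa [intro]: "ar P f \<in> Hom C' (ob P Y) (ob P X)" if "f \<in> Hom C X Y" for f X Y
    using hat.ar_in that by (auto simp: Hom_op_cat defs)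
  have Qa [intro]: "ar Q f \<in> Hom C (ob Q Y) (ob Q X)" if "f \<in> Hom C' X Y" for f X Y
    using cohat.ar_in that by (auto simp: Hom_op_cat defs)
  have Pi: "ar P (Ide C X) = Ide C' (ob P X)" if "X \<in> Obj C" for X
    using hat.ar_Ide that by (auto simp: op_cat_simps defs)
  have Qi: "ar Q (Ide C' X) = Ide C (ob Q X)" if "X \<in> Obj C'" for X
    using cohat.ar_Ide that by (auto simp: op_cat_simps defs)
  have Pc: "ar P (g \<cdot>\<^bsub>C\<^esub> f) = ar P f \<cdot>\<^bsub>C'\<^esub> ar P g" if "f \<in> Hom C X Y" "g \<in> Hom C Y Z" for f g X Y Z
    using hat.ar_Comp[of g Z Y f X] that by (auto simp: op_cat_simps Hom_op_cat defs)
  have Qc: "ar Q (g \<cdot>\<^bsub>C'\<^esub> f) = ar Q f \<cdot>\<^bsub>C\<^esub> ar Q g" if "f \<in> Hom C' X Y" "g \<in> Hom C' Y Z" for f g X Y Z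
    using cohat.ar_Comp[of g Z Y f X] that by (auto simp: op_cat_simps Hom_op_cat defs)
  have aa [intro]: "a X \<in> Hom C' X (ob P (ob Q X))" if "X \<in> Obj C'" for X
    using hat_iso.component_in that by (auto simp: fun_id_def fun_comp_def defs)
  have bb [intro]: "b X \<in> Hom C X (ob Q (ob P X))" if "X \<in> Obj C" for X
    using cohat_iso.component_in that by (auto simp: fun_id_def fun_comp_def defs)
  have an: "a Y \<cdot>\<^bsub>C'\<^esub> f = ar P (ar Q f) \<cdot>\<^bsub>C'\<^esub> a X" if "f \<in> Hom C' X Y" for f X Y
    using hat_iso.naturality that by (auto simp: fun_id_def fun_comp_def defs)
  have bn: "b Y \<cdot>\<^bsub>C\<^esub> f = ar Q (ar P f) \<cdot>\<^bsub>C\<^esub> b X" if "f \<in> Hom C X Y" for f X Y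
    using cohat_iso.naturality that by (auto simp: fun_id_def fun_comp_def defs)
  have "\<exists>g. inverse_arrows C' (a X) g" if "X \<in> Obj C'" for X
    using hat_iso.component_iso that by (auto simp: iso_def defs)
  then obtain ai where ai: "inverse_arrows C' (a X) (ai X)" if "X \<in> Obj C'" for X by metis
  have "\<exists>g. inverse_arrows C (b X) g" if "X \<in> Obj C" for X
    using cohat_iso.component_iso that by (auto simp: iso_def defs)
  then obtain bi where bi: "inverse_arrows C (b X) (bi X)" if "X \<in> Obj C" for X by metis
  have ai1 [intro]: "ai X \<in> Hom C' (ob P (ob Q X)) X"
    and ai2: "ai X \<cdot>\<^bsub>C'\<^esub> a X = Ide C' X" and ai3: "a X \<cdot>\<^bsub>C'\<^esub> ai X = Ide C' (ob P (ob Q X))"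
    if "X \<in> Obj C'" for X
    using ai[OF that] aa[OF that] by (auto simp: inverse_arrows_def Hom_def)
  have bi1 [intro]: "bi X \<in> Hom C (ob Q (ob P X)) X"
    and bi2: "bi X \<cdot>\<^bsub>C\<^esub> b X = Ide C X" and bi3: "b X \<cdot>\<^bsub>C\<^esub> bi X = Ide C (ob Q (ob P X))"
    if "X \<in> Obj C" for X
    using bi[OF that] bb[OF that] by (auto simp: inverse_arrows_def Hom_def)
  have bin: "bi Y \<cdot>\<^bsub>C\<^esub> ar Q (ar P f) = f \<cdot>\<^bsub>C\<^esub> bi X" if f: "f \<in> Hom C X Y" for f X Y
  proof -
    have X: "X \<in> Obj C" and Y: "Y \<in> Obj C" using HD f by auto
    have QPf: "ar Q (ar P f) \<in> Hom C (ob Q (ob P X)) (ob Q (ob P Y))" using f by auto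
    have "bi Y \<cdot>\<^bsub>C\<^esub> ar Q (ar P f) = bi Y \<cdot>\<^bsub>C\<^esub> (ar Q (ar P f) \<cdot>\<^bsub>C\<^esub> (b X \<cdot>\<^bsub>C\<^esub> bi X))"
      using bi3[OF X] cohat.B.Comp_Ide[OF QPf] by simp
    also have "\<dots> = bi Y \<cdot>\<^bsub>C\<^esub> ((b Y \<cdot>\<^bsub>C\<^esub> f) \<cdot>\<^bsub>C\<^esub> bi X)"
      using cohat.B.Comp_assoc[OF bi1[OF X] bb[OF X] QPf] bn[OF f] by simp
    also have "\<dots> = (bi Y \<cdot>\<^bsub>C\<^esub> b Y) \<cdot>\<^bsub>C\<^esub> (f \<cdot>\<^bsub>C\<^esub> bi X)"
      using cohat.B.Comp_assoc[OF bi1[OF X] f bb[OF Y]]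
        cohat.B.Comp_assoc[OF cohat.B.Comp_in[OF bi1[OF X] f] bb[OF Y] bi1[OF Y]] by simp
    also have "\<dots> = f \<cdot>\<^bsub>C\<^esub> bi X"
      using bi2[OF Y] cohat.B.Ide_Comp[OF cohat.B.Comp_in[OF bi1[OF X] f]] by simp
    finally show ?thesis .
  qed
  have aPQ: "ar P (ar Q (a X)) = a (ob P (ob Q X))" if X: "X \<in> Obj C'" for X
  proof -
    have 1: "ar P (ar Q (a X)) \<in> Hom C' (ob P (ob Q X)) (ob P (ob Q (ob P (ob Q X))))"
      using X by auto
    have 2: "a (ob P (ob Q X)) \<in> Hom C' (ob P (ob Q X)) (ob P (ob Q (ob P (ob Q X))))"
      using X by auto
    have "(ar P (ar Q (a X)) \<cdot>\<^bsub>C'\<^esub> a X) \<cdot>\<^bsub>C'\<^esub> ai X = (a (ob P (ob Q X)) \<cdot>\<^bsub>C'\<^esub> a X) \<cdot>\<^bsub>C'\<^esub> ai X"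
      using an[OF aa[OF X]] by simp
    then show ?thesis
      using hat.B.Comp_assoc[OF ai1[OF X] aa[OF X] 1] hat.B.Comp_assoc[OF ai1[OF X] aa[OF X] 2]
        ai3[OF X] hat.B.Comp_Ide[OF 1] hat.B.Comp_Ide[OF 2] by simp
  qed
  have Q_faithful: "f = g" if f: "f \<in> Hom C' X Y" and g: "g \<in> Hom C' X Y" and "ar Q f = ar Q g"
    for f g X Y
  proof -
    have Y: "Y \<in> Obj C'" using HD' f by auto
    have "a Y \<cdot>\<^bsub>C'\<^esub> f = a Y \<cdot>\<^bsub>C'\<^esub> g" using an[OF f] an[OF g] that(3) by simp
    then have "ai Y \<cdot>\<^bsub>C'\<^esub> (a Y \<cdot>\<^bsub>C'\<^esub> f) = ai Y \<cdot>\<^bsub>C'\<^esub> (a Y \<cdot>\<^bsub>C'\<^esub> g)" by simp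
    then show ?thesis
      using hat.B.Comp_assoc[OF f aa[OF Y] ai1[OF Y]] hat.B.Comp_assoc[OF g aa[OF Y] ai1[OF Y]]
        ai2[OF Y] hat.B.Ide_Comp[OF f] hat.B.Ide_Comp[OF g] by simp
  qed
  define q where "q Y = ar Q (ai (ob P Y))" for Y
  have q [intro]: "q Y \<in> Hom C (ob Q (ob P Y)) (ob Q (ob P (ob Q (ob P Y))))"
    if "Y \<in> Obj C" for Y using that unfolding q_def by auto
  define b2 where "b2 Y = bi (ob Q (ob P Y)) \<cdot>\<^bsub>C\<^esub> (q Y \<cdot>\<^bsub>C\<^esub> b Y)" for Y
  have b2 [intro]: "b2 Y \<in> Hom C Y (ob Q (ob P Y))" if "Y \<in> Obj C" for Y
    unfolding b2_def using that by (auto intro!: cohat.B.Comp_in)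
  have ain: "f \<cdot>\<^bsub>C'\<^esub> ai X = ai Y \<cdot>\<^bsub>C'\<^esub> ar P (ar Q f)" if f: "f \<in> Hom C' X Y" for f X Y
  proof -
    have X: "X \<in> Obj C'" and Y: "Y \<in> Obj C'" using HD' f by auto
    have QPf: "ar P (ar Q f) \<in> Hom C' (ob P (ob Q X)) (ob P (ob Q Y))" using f by auto
    have "ai Y \<cdot>\<^bsub>C'\<^esub> ar P (ar Q f) = ai Y \<cdot>\<^bsub>C'\<^esub> (ar P (ar Q f) \<cdot>\<^bsub>C'\<^esub> (a X \<cdot>\<^bsub>C'\<^esub> ai X))"
      using ai3[OF X] hat.B.Comp_Ide[OF QPf] by simp
    also have "\<dots> = ai Y \<cdot>\<^bsub>C'\<^esub> ((a Y \<cdot>\<^bsub>C'\<^esub> f) \<cdot>\<^bsub>C'\<^esub> ai X)"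
      using hat.B.Comp_assoc[OF ai1[OF X] aa[OF X] QPf] an[OF f] by simp
    also have "\<dots> = (ai Y \<cdot>\<^bsub>C'\<^esub> a Y) \<cdot>\<^bsub>C'\<^esub> (f \<cdot>\<^bsub>C'\<^esub> ai X)"
      using hat.B.Comp_assoc[OF ai1[OF X] f aa[OF Y]]
        hat.B.Comp_assoc[OF hat.B.Comp_in[OF ai1[OF X] f] aa[OF Y] ai1[OF Y]] by simp
    also have "\<dots> = f \<cdot>\<^bsub>C'\<^esub> ai X"
      using ai2[OF Y] hat.B.Ide_Comp[OF hat.B.Comp_in[OF ai1[OF X] f]] by simp
    finally show ?thesis by simp
  qed
  have b2n: "b2 Y \<cdot>\<^bsub>C\<^esub> f = ar Q (ar P f) \<cdot>\<^bsub>C\<^esub> b2 X" if f: "f \<in> Hom C X Y" for f X Y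
  proof -
    have X: "X \<in> Obj C" and Y: "Y \<in> Obj C" using HD f by auto
    let ?F = "ar Q (ar P f)"
    let ?X = "ob Q (ob P X)" and ?Y = "ob Q (ob P Y)"
    have F: "?F \<in> Hom C ?X ?Y" using f by auto
    have FF: "ar Q (ar P ?F) \<in> Hom C (ob Q (ob P ?X)) (ob Q (ob P ?Y))" using F by auto
    have qn: "q Y \<cdot>\<^bsub>C\<^esub> ?F = ar Q (ar P ?F) \<cdot>\<^bsub>C\<^esub> q X"
    proof -
      have Pf: "ar P f \<in> Hom C' (ob P Y) (ob P X)" using f by auto
      have "ar Q (ar P f \<cdot>\<^bsub>C'\<^esub> ai (ob P Y)) = q Y \<cdot>\<^bsub>C\<^esub> ?F"
        unfolding q_def by (rule Qc[OF ai1[OF Po[OF Y]] Pf])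
      moreover have "ar Q (ai (ob P X) \<cdot>\<^bsub>C'\<^esub> ar P ?F) = ar Q (ar P ?F) \<cdot>\<^bsub>C\<^esub> q X"
        unfolding q_def by (rule Qc[OF Pa[OF F] ai1[OF Po[OF X]]])
      ultimately show ?thesis using ain[OF Pf] by simp
    qed
    have qX: "q X \<in> Hom C ?X (ob Q (ob P ?X))" and qY: "q Y \<in> Hom C ?Y (ob Q (ob P ?Y))"
      using q X Y by auto
    have biX: "bi ?X \<in> Hom C (ob Q (ob P ?X)) ?X" and biY: "bi ?Y \<in> Hom C (ob Q (ob P ?Y)) ?Y"
      using X Y by auto
    have "b2 Y \<cdot>\<^bsub>C\<^esub> f = bi ?Y \<cdot>\<^bsub>C\<^esub> (q Y \<cdot>\<^bsub>C\<^esub> (b Y \<cdot>\<^bsub>C\<^esub> f))"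
      unfolding b2_def
      using cohat.B.Comp_assoc[OF f bb[OF Y] qY] cohat.B.Comp_assoc[OF f cohat.B.Comp_in[OF bb[OF Y] qY] biY] by simp
    also have "\<dots> = bi ?Y \<cdot>\<^bsub>C\<^esub> ((q Y \<cdot>\<^bsub>C\<^esub> ?F) \<cdot>\<^bsub>C\<^esub> b X)"
      using bn[OF f] cohat.B.Comp_assoc[OF bb[OF X] F qY] by simp
    also have "\<dots> = bi ?Y \<cdot>\<^bsub>C\<^esub> (ar Q (ar P ?F) \<cdot>\<^bsub>C\<^esub> (q X \<cdot>\<^bsub>C\<^esub> b X))"
      using qn cohat.B.Comp_assoc[OF bb[OF X] qX FF] by simp
    also have "\<dots> = (?F \<cdot>\<^bsub>C\<^esub> bi ?X) \<cdot>\<^bsub>C\<^esub> (q X \<cdot>\<^bsub>C\<^esub> b X)"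
      using bin[OF F] cohat.B.Comp_assoc[OF cohat.B.Comp_in[OF bb[OF X] qX] FF biY] by simp
    also have "\<dots> = ?F \<cdot>\<^bsub>C\<^esub> b2 X"
      unfolding b2_def using cohat.B.Comp_assoc[OF cohat.B.Comp_in[OF bb[OF X] qX] biX F] by simp
    finally show ?thesis .
  qed
  have inv_comp: "\<exists>k. inverse_arrows C (g \<cdot>\<^bsub>C\<^esub> f) k"
    if f: "f \<in> Hom C X Y" and g: "g \<in> Hom C Y Z" and fi: "inverse_arrows C f f'" and gi: "inverse_arrows C g g'"
    for f g f' g' X Y Z
  proof -
    have f': "f' \<in> Hom C Y X" "f' \<cdot>\<^bsub>C\<^esub> f = Ide C X" "f \<cdot>\<^bsub>C\<^esub> f' = Ide C Y"
      using fi f by (auto simp: inverse_arrows_def Hom_def)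
    have g': "g' \<in> Hom C Z Y" "g' \<cdot>\<^bsub>C\<^esub> g = Ide C Y" "g \<cdot>\<^bsub>C\<^esub> g' = Ide C Z"
      using gi g by (auto simp: inverse_arrows_def Hom_def)
    have gf: "g \<cdot>\<^bsub>C\<^esub> f \<in> Hom C X Z" and fg: "f' \<cdot>\<^bsub>C\<^esub> g' \<in> Hom C Z X"
      using cohat.B.Comp_in f g f' g' by auto
    have 1: "(f' \<cdot>\<^bsub>C\<^esub> g') \<cdot>\<^bsub>C\<^esub> (g \<cdot>\<^bsub>C\<^esub> f) = Ide C X"
      using cohat.B.Comp_assoc[OF gf g'(1) f'(1)] cohat.B.Comp_assoc[OF f g g'(1)] g' f' cohat.B.Ide_Comp[OF f] by simp
    have 2: "(g \<cdot>\<^bsub>C\<^esub> f) \<cdot>\<^bsub>C\<^esub> (f' \<cdot>\<^bsub>C\<^esub> g') = Ide C Z"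
      using cohat.B.Comp_assoc[OF fg f g] cohat.B.Comp_assoc[OF g'(1) f'(1) f] g' f' cohat.B.Ide_Comp[OF g'(1)] by simp
    have "inverse_arrows C (g \<cdot>\<^bsub>C\<^esub> f) (f' \<cdot>\<^bsub>C\<^esub> g')"
      using 1 2 gf fg by (auto simp: inverse_arrows_def Hom_def)
    then show ?thesis ..
  qed
  have b2i: "iso C (b2 Y)" if Y: "Y \<in> Obj C" for Y
  proof -
    let ?Y = "ob Q (ob P Y)"
    have PY: "ob P Y \<in> Obj C'" and QPY: "?Y \<in> Obj C" using Y by auto
    have qi: "inverse_arrows C (q Y) (ar Q (a (ob P Y)))"
    proof -
      have "ar Q (a (ob P Y)) \<cdot>\<^bsub>C\<^esub> q Y = Ide C ?Y"
        unfolding q_def using Qc[OF aa[OF PY] ai1[OF PY]] ai2[OF PY] Qi[OF PY] by simp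
      moreover have "q Y \<cdot>\<^bsub>C\<^esub> ar Q (a (ob P Y)) = Ide C (ob Q (ob P ?Y))"
        unfolding q_def using Qc[OF ai1[OF PY] aa[OF PY]] ai3[OF PY] Qi[of "ob P ?Y"] QPY by auto
      ultimately show ?thesis
        using q[OF Y] Qa[OF aa[OF PY]] by (auto simp: inverse_arrows_def Hom_def)
    qed
    have bii: "inverse_arrows C (bi ?Y) (b ?Y)"
      using bi[OF QPY] bi1[OF QPY] bb[OF QPY] by (auto simp: inverse_arrows_def Hom_def)
    obtain r where r: "inverse_arrows C (q Y \<cdot>\<^bsub>C\<^esub> b Y) r"
      using inv_comp[OF bb[OF Y] q[OF Y] bi[OF Y] qi] by auto
    show ?thesis
      unfolding iso_def b2_def
      by (rule inv_comp[OF cohat.B.Comp_in[OF bb[OF Y] q[OF Y]] bi1[OF QPY] r bii])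
  qed
  have t1: "ar Q (a X) \<cdot>\<^bsub>C\<^esub> b2 (ob Q X) = Ide C (ob Q X)" if X: "X \<in> Obj C'" for X
  proof -
    let ?X = "ob Q X"
    have X1: "?X \<in> Obj C" and X2: "ob P ?X \<in> Obj C'" and X3: "ob Q (ob P ?X) \<in> Obj C" using X by auto
    have Qa': "ar Q (a X) \<in> Hom C (ob Q (ob P ?X)) ?X" using X by auto
    have 1: "ar Q (ar P (ar Q (a X))) \<cdot>\<^bsub>C\<^esub> q ?X = Ide C (ob Q (ob P ?X))"
      unfolding q_def aPQ[OF X]
      using Qc[OF aa[OF X2] ai1[OF X2]] ai2[OF X2] Qi[OF X2] by simp
    have QPQ: "ar Q (ar P (ar Q (a X))) \<in> Hom C (ob Q (ob P (ob Q (ob P ?X)))) (ob Q (ob P ?X))"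
      using Qa' by auto
    have "ar Q (a X) \<cdot>\<^bsub>C\<^esub> b2 ?X = (ar Q (a X) \<cdot>\<^bsub>C\<^esub> bi (ob Q (ob P ?X))) \<cdot>\<^bsub>C\<^esub> (q ?X \<cdot>\<^bsub>C\<^esub> b ?X)"
      unfolding b2_def
      using cohat.B.Comp_assoc[OF cohat.B.Comp_in[OF bb[OF X1] q[OF X1]] bi1[OF X3] Qa'] by simp
    also have "\<dots> = (bi ?X \<cdot>\<^bsub>C\<^esub> ar Q (ar P (ar Q (a X)))) \<cdot>\<^bsub>C\<^esub> (q ?X \<cdot>\<^bsub>C\<^esub> b ?X)"
      using bin[OF Qa'] by simp
    also have "\<dots> = bi ?X \<cdot>\<^bsub>C\<^esub> ((ar Q (ar P (ar Q (a X))) \<cdot>\<^bsub>C\<^esub> q ?X) \<cdot>\<^bsub>C\<^esub> b ?X)"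
      using cohat.B.Comp_assoc[OF cohat.B.Comp_in[OF bb[OF X1] q[OF X1]] QPQ bi1[OF X1]]
        cohat.B.Comp_assoc[OF bb[OF X1] q[OF X1] QPQ] by simp
    also have "\<dots> = Ide C ?X" using 1 cohat.B.Ide_Comp[OF bb[OF X1]] bi2[OF X1] by simp
    finally show ?thesis .
  qed
  have b2QP: "ar Q (ar P (b2 Y)) = b2 (ob Q (ob P Y))" if Y: "Y \<in> Obj C" for Y
  proof -
    let ?Y = "ob Q (ob P Y)"
    have 1: "ar Q (ar P (b2 Y)) \<in> Hom C ?Y (ob Q (ob P ?Y))" using Y by auto
    have 2: "b2 ?Y \<in> Hom C ?Y (ob Q (ob P ?Y))" using Y by auto
    obtain g where "inverse_arrows C (b2 Y) g" using b2i[OF Y] by (auto simp: iso_def)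
    then have g: "g \<in> Hom C ?Y Y" "b2 Y \<cdot>\<^bsub>C\<^esub> g = Ide C ?Y"
      using b2[OF Y] by (auto simp: inverse_arrows_def Hom_def)
    have "(ar Q (ar P (b2 Y)) \<cdot>\<^bsub>C\<^esub> b2 Y) \<cdot>\<^bsub>C\<^esub> g = (b2 ?Y \<cdot>\<^bsub>C\<^esub> b2 Y) \<cdot>\<^bsub>C\<^esub> g"
      using b2n[OF b2[OF Y]] by simp
    then show ?thesis
      using cohat.B.Comp_assoc[OF g(1) b2[OF Y] 1] cohat.B.Comp_assoc[OF g(1) b2[OF Y] 2]
        g(2) cohat.B.Comp_Ide[OF 1] cohat.B.Comp_Ide[OF 2] by simp
  qed
  have t2: "ar P (b2 Y) \<cdot>\<^bsub>C'\<^esub> a (ob P Y) = Ide C' (ob P Y)" if Y: "Y \<in> Obj C" for Y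
  proof (rule Q_faithful)
    have PY: "ob P Y \<in> Obj C'" using Y by auto
    show "ar P (b2 Y) \<cdot>\<^bsub>C'\<^esub> a (ob P Y) \<in> Hom C' (ob P Y) (ob P Y)"
      using hat.B.Comp_in[OF aa[OF PY] Pa[OF b2[OF Y]]] .
    show "Ide C' (ob P Y) \<in> Hom C' (ob P Y) (ob P Y)" using hat.B.Ide_in[OF PY] .
    show "ar Q (ar P (b2 Y) \<cdot>\<^bsub>C'\<^esub> a (ob P Y)) = ar Q (Ide C' (ob P Y))"
      using Qc[OF aa[OF PY] Pa[OF b2[OF Y]]] b2QP[OF Y] t1[OF PY] Qi[OF PY] by simp
  qed
  have "nat_iso C C fun_id (Q \<circ>\<^sub>F P) b2"
    unfolding nat_iso_def nat_trans_def
    using cohat_iso.F.is_functor_axioms cohat_iso.G.is_functor_axioms b2 b2n b2i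
    by (auto simp: nat_trans_axioms_def nat_iso_axioms_def defs fun_id_def fun_comp_def)
  then have "dual_adjoint_equivalence C C' (d\<lparr>cohat_iso := b2\<rparr>)"
    using t1 t2 hat.is_functor_axioms cohat.is_functor_axioms hat_iso.nat_iso_axioms
    by (auto simp: dual_adjoint_equivalence_def dual_equivalence_def
        dual_adjoint_equivalence_axioms_def defs)
  then show ?thesis by (rule exI[of _ b2])
qed


section \<open>Monoidal structure\<close>

text \<open>
  A category with tensor product on objects and arrows and a unit object.  Associators and
  unitors are not recorded: they are identities in the strict case, and operators on a
  non-strict monoidal category only refer to its tensor and unit.
\<close>

record ('o, 'a) moncat = "('o, 'a) cat" +
  TensorO :: "'o \<Rightarrow> 'o \<Rightarrow> 'o"  (infixr "\<otimes>\<index>" 75)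
  TensorA :: "'a \<Rightarrow> 'a \<Rightarrow> 'a"  (infixr "\<boxtimes>\<index>" 75)
  UnitO :: "'o"  ("\<I>\<index>")

locale strict_monoidal = category C
  for C :: "('o, 'a, 'm) moncat_scheme" (structure) +
  assumes TensorO_in: "\<lbrakk>X \<in> Obj C; Y \<in> Obj C\<rbrakk> \<Longrightarrow> X \<otimes> Y \<in> Obj C"
    and TensorA_in: "\<lbrakk>f \<in> Hom C X Y; g \<in> Hom C X' Y'\<rbrakk>
      \<Longrightarrow> f \<boxtimes> g \<in> Hom C (X \<otimes> X') (Y \<otimes> Y')"
    and UnitO_in: "\<I> \<in> Obj C"
    and TensorA_Ide: "\<lbrakk>X \<in> Obj C; Y \<in> Obj C\<rbrakk> \<Longrightarrow> Ide C X \<boxtimes> Ide C Y = Ide C (X \<otimes> Y)"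
    and TensorA_Comp: "\<lbrakk>f \<in> Hom C X Y; g \<in> Hom C Y Z; f' \<in> Hom C X' Y'; g' \<in> Hom C Y' Z'\<rbrakk>
      \<Longrightarrow> (g \<cdot> f) \<boxtimes> (g' \<cdot> f') = (g \<boxtimes> g') \<cdot> (f \<boxtimes> f')"
    and TensorO_assoc: "\<lbrakk>X \<in> Obj C; Y \<in> Obj C; Z \<in> Obj C\<rbrakk>
      \<Longrightarrow> (X \<otimes> Y) \<otimes> Z = X \<otimes> (Y \<otimes> Z)"
    and TensorA_assoc: "\<lbrakk>f \<in> Arr C; g \<in> Arr C; h \<in> Arr C\<rbrakk>
      \<Longrightarrow> (f \<boxtimes> g) \<boxtimes> h = f \<boxtimes> (g \<boxtimes> h)"
    and UnitO_TensorO: "X \<in> Obj C \<Longrightarrow> \<I> \<otimes> X = X"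
    and TensorO_UnitO: "X \<in> Obj C \<Longrightarrow> X \<otimes> \<I> = X"
    and UnitO_TensorA: "f \<in> Arr C \<Longrightarrow> Ide C \<I> \<boxtimes> f = f"
    and TensorA_UnitO: "f \<in> Arr C \<Longrightarrow> f \<boxtimes> Ide C \<I> = f"

locale strong_monoidal_functor = C: strict_monoidal C + D: strict_monoidal D + U: is_functor C D U
  for C :: "('o, 'a, 'm) moncat_scheme" and D :: "('p, 'b, 'n) moncat_scheme"
    and U :: "('o, 'a, 'p, 'b) fun_data" +
  fixes l :: "'o \<Rightarrow> 'o \<Rightarrow> 'b" and e :: 'b
  assumes l_in: "\<lbrakk>X \<in> Obj C; Y \<in> Obj C\<rbrakk>
      \<Longrightarrow> l X Y \<in> Hom D (ob U X \<otimes>\<^bsub>D\<^esub> ob U Y) (ob U (X \<otimes>\<^bsub>C\<^esub> Y))"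
    and l_iso: "\<lbrakk>X \<in> Obj C; Y \<in> Obj C\<rbrakk> \<Longrightarrow> iso D (l X Y)"
    and l_natural: "\<lbrakk>f \<in> Hom C X Y; f' \<in> Hom C X' Y'\<rbrakk>
      \<Longrightarrow> l Y Y' \<cdot>\<^bsub>D\<^esub> (ar U f \<boxtimes>\<^bsub>D\<^esub> ar U f') = ar U (f \<boxtimes>\<^bsub>C\<^esub> f') \<cdot>\<^bsub>D\<^esub> l X X'"
    and e_in: "e \<in> Hom D \<I>\<^bsub>D\<^esub> (ob U \<I>\<^bsub>C\<^esub>)"
    and e_iso: "iso D e"
    and l_assoc: "\<lbrakk>X \<in> Obj C; Y \<in> Obj C; Z \<in> Obj C\<rbrakk>
      \<Longrightarrow> l (X \<otimes>\<^bsub>C\<^esub> Y) Z \<cdot>\<^bsub>D\<^esub> (l X Y \<boxtimes>\<^bsub>D\<^esub> Ide D (ob U Z)) =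
          l X (Y \<otimes>\<^bsub>C\<^esub> Z) \<cdot>\<^bsub>D\<^esub> (Ide D (ob U X) \<boxtimes>\<^bsub>D\<^esub> l Y Z)"
    and l_unit_left: "X \<in> Obj C
      \<Longrightarrow> l \<I>\<^bsub>C\<^esub> X \<cdot>\<^bsub>D\<^esub> (e \<boxtimes>\<^bsub>D\<^esub> Ide D (ob U X)) = Ide D (ob U X)"
    and l_unit_right: "X \<in> Obj C
      \<Longrightarrow> l X \<I>\<^bsub>C\<^esub> \<cdot>\<^bsub>D\<^esub> (Ide D (ob U X) \<boxtimes>\<^bsub>D\<^esub> e) = Ide D (ob U X)"

text \<open>
  Tensor powers.  In the non-strict case brackets are associated to the right; the first power
  of \<open>X\<close> is \<open>X\<close> itself, not \<open>X\<close> tensored with the unit.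
\<close>

fun powO :: "('o, 'a, 'm) moncat_scheme \<Rightarrow> 'o \<Rightarrow> nat \<Rightarrow> 'o" where
  "powO C X 0 = \<I>\<^bsub>C\<^esub>"
| "powO C X (Suc 0) = X"
| "powO C X (Suc (Suc n)) = X \<otimes>\<^bsub>C\<^esub> powO C X (Suc n)"

fun powA :: "('o, 'a, 'm) moncat_scheme \<Rightarrow> 'a \<Rightarrow> nat \<Rightarrow> 'a" where
  "powA C f 0 = Ide C \<I>\<^bsub>C\<^esub>"
| "powA C f (Suc 0) = f"
| "powA C f (Suc (Suc n)) = f \<boxtimes>\<^bsub>C\<^esub> powA C f (Suc n)"


section \<open>Duals of functors, monoidal structures and adjunctions\<close>

definition dual_functor ::
  "('o, 'a, 'o1, 'a1) dual_data \<Rightarrow> ('p, 'b, 'p1, 'b1) dual_data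
   \<Rightarrow> ('o, 'a, 'p, 'b) fun_data \<Rightarrow> ('o1, 'a1, 'p1, 'b1) fun_data" where
  "dual_functor dA dB G = hat dB \<circ>\<^sub>F G \<circ>\<^sub>F cohat dA"

definition dual_moncat ::
  "('o, 'a) moncat \<Rightarrow> ('p, 'b) cat \<Rightarrow> ('o, 'a, 'p, 'b) dual_data \<Rightarrow> ('p, 'b) moncat" where
  "dual_moncat C C' d =
    \<lparr>Obj = Obj C', Arr = Arr C', Dom = Dom C', Cod = Cod C', Ide = Ide C', Comp = Comp C',
     TensorO = (\<lambda>X Y. ob (hat d) (ob (cohat d) X \<otimes>\<^bsub>C\<^esub> ob (cohat d) Y)),
     TensorA = (\<lambda>f g. ar (hat d) (ar (cohat d) f \<boxtimes>\<^bsub>C\<^esub> ar (cohat d) g)),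
     UnitO = ob (hat d) \<I>\<^bsub>C\<^esub>\<rparr>"

text \<open>
  The duals of counit, unit and (inverse) strong monoidal structure of an adjunction between
  \<open>F: D \<rightarrow> C\<close> (left adjoint) and \<open>U: C \<rightarrow> D\<close>.
  The isomorphisms of an object with its double dual, which are usually suppressed, are
  inserted where they are needed:
  \<open>dual_counit X: X \<rightarrow> hF (hU X)\<close>, \<open>dual_unit Y: hU (hF Y) \<rightarrow> Y\<close> and
  \<open>dual_laxator X Y: hU X \<otimes> hU Y \<rightarrow> hU (X \<otimes> Y)\<close>, for the duals \<open>hF\<close>, \<open>hU\<close> of \<open>F\<close>, \<open>U\<close>.
\<close>

definition dual_counit ::
  "('o, 'a, 'm) cat_scheme \<Rightarrow> ('p, 'b, 'n) cat_scheme \<Rightarrow> ('o1, 'a1, 'm1) cat_scheme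
   \<Rightarrow> ('o, 'a, 'o1, 'a1) dual_data \<Rightarrow> ('p, 'b, 'p1, 'b1) dual_data
   \<Rightarrow> ('p, 'b, 'o, 'a) fun_data \<Rightarrow> ('o, 'a, 'p, 'b) fun_data \<Rightarrow> ('o \<Rightarrow> 'a) \<Rightarrow> 'o1 \<Rightarrow> 'a1" where
  "dual_counit C D C' dC dD F U \<epsilon> X =
     ar (hat dC) (ar F (inv_arr D (cohat_iso dD (ob U (ob (cohat dC) X)))))
     \<cdot>\<^bsub>C'\<^esub> ar (hat dC) (\<epsilon> (ob (cohat dC) X))
     \<cdot>\<^bsub>C'\<^esub> hat_iso dC X"

definition dual_unit ::
  "('p1, 'b1, 'n1) cat_scheme
   \<Rightarrow> ('o, 'a, 'o1, 'a1) dual_data \<Rightarrow> ('p, 'b, 'p1, 'b1) dual_data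
   \<Rightarrow> ('p, 'b, 'o, 'a) fun_data \<Rightarrow> ('o, 'a, 'p, 'b) fun_data \<Rightarrow> ('p \<Rightarrow> 'b) \<Rightarrow> 'p1 \<Rightarrow> 'b1" where
  "dual_unit D' dC dD F U \<eta> Y =
     inv_arr D' (hat_iso dD Y)
     \<cdot>\<^bsub>D'\<^esub> ar (hat dD) (\<eta> (ob (cohat dD) Y))
     \<cdot>\<^bsub>D'\<^esub> ar (hat dD) (ar U (cohat_iso dC (ob F (ob (cohat dD) Y))))"

definition dual_laxator ::
  "('o, 'a, 'm) moncat_scheme \<Rightarrow> ('p, 'b, 'n) moncat_scheme \<Rightarrow> ('p1, 'b1, 'n1) cat_scheme
   \<Rightarrow> ('o, 'a, 'o1, 'a1) dual_data \<Rightarrow> ('p, 'b, 'p1, 'b1) dual_data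
   \<Rightarrow> ('o, 'a, 'p, 'b) fun_data \<Rightarrow> ('o \<Rightarrow> 'o \<Rightarrow> 'b) \<Rightarrow> 'o1 \<Rightarrow> 'o1 \<Rightarrow> 'b1" where
  "dual_laxator C D D' dC dD U l X Y =
     (let A = ob (cohat dC) X; B = ob (cohat dC) Y in
      ar (hat dD) (ar U (inv_arr C (cohat_iso dC (A \<otimes>\<^bsub>C\<^esub> B))))
      \<cdot>\<^bsub>D'\<^esub> ar (hat dD) (inv_arr D (l A B))
      \<cdot>\<^bsub>D'\<^esub> ar (hat dD) (cohat_iso dD (ob U A) \<boxtimes>\<^bsub>D\<^esub> cohat_iso dD (ob U B)))"


section \<open>Monoidal monads and Kleisli categories\<close>

record ('o, 'a) monad_data =
  Mfun :: "('o, 'a, 'o, 'a) fun_data"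
  Munit :: "'o \<Rightarrow> 'a"
  Mmult :: "'o \<Rightarrow> 'a"
  Mlax :: "'o \<Rightarrow> 'o \<Rightarrow> 'a"

text \<open>
  The lax monoidal structure \<open>R X \<otimes> R Y \<rightarrow> R (X \<otimes> Y)\<close> of the right adjoint of a strong monoidal
  functor \<open>L: A \<rightarrow> B\<close> with structure \<open>l\<close>.
\<close>

definition right_adjoint_lax ::
  "('o, 'a, 'm) moncat_scheme \<Rightarrow> ('p, 'b, 'n) moncat_scheme
   \<Rightarrow> ('p, 'b, 'o, 'a) fun_data \<Rightarrow> ('o \<Rightarrow> 'a) \<Rightarrow> ('p \<Rightarrow> 'b)
   \<Rightarrow> ('o \<Rightarrow> 'o \<Rightarrow> 'b) \<Rightarrow> 'p \<Rightarrow> 'p \<Rightarrow> 'a" where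
  "right_adjoint_lax A B R \<eta> \<epsilon> l X Y =
     ar R (\<epsilon> X \<boxtimes>\<^bsub>B\<^esub> \<epsilon> Y)
     \<cdot>\<^bsub>A\<^esub> ar R (inv_arr B (l (ob R X) (ob R Y)))
     \<cdot>\<^bsub>A\<^esub> \<eta> (ob R X \<otimes>\<^bsub>A\<^esub> ob R Y)"

text \<open>The monoidal monad \<open>R L\<close> of an adjunction whose left adjoint \<open>L\<close> is strong monoidal.\<close>

definition adjunction_monad ::
  "('o, 'a, 'm) moncat_scheme \<Rightarrow> ('p, 'b, 'n) moncat_scheme
   \<Rightarrow> ('o, 'a, 'p, 'b) fun_data \<Rightarrow> ('p, 'b, 'o, 'a) fun_data
   \<Rightarrow> ('o \<Rightarrow> 'a) \<Rightarrow> ('p \<Rightarrow> 'b) \<Rightarrow> ('o \<Rightarrow> 'o \<Rightarrow> 'b) \<Rightarrow> ('o, 'a) monad_data" where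
  "adjunction_monad A B L R \<eta> \<epsilon> l =
    \<lparr>Mfun = R \<circ>\<^sub>F L, Munit = \<eta>, Mmult = (\<lambda>X. ar R (\<epsilon> (ob L X))),
     Mlax = (\<lambda>X Y. ar R (l X Y) \<cdot>\<^bsub>A\<^esub> right_adjoint_lax A B R \<eta> \<epsilon> l (ob L X) (ob L Y))\<rparr>"

text \<open>
  A Kleisli morphism \<open>f: X \<rightarrow> T Y\<close> is the triple \<open>(X, f, Y)\<close>, since \<open>Y\<close> cannot be recovered
  from \<open>f\<close>.
\<close>

definition kleisli ::
  "('o, 'a, 'm) moncat_scheme \<Rightarrow> ('o, 'a) monad_data \<Rightarrow> ('o, 'o \<times> 'a \<times> 'o) moncat" where
  "kleisli C T =
    \<lparr>Obj = Obj C,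
     Arr = {(X, f, Y). X \<in> Obj C \<and> Y \<in> Obj C \<and> f \<in> Hom C X (ob (Mfun T) Y)},
     Dom = (\<lambda>(X, f, Y). X),
     Cod = (\<lambda>(X, f, Y). Y),
     Ide = (\<lambda>X. (X, Munit T X, X)),
     Comp = (\<lambda>(Y, g, Z) (X, f, Y'). (X, Mmult T Z \<cdot>\<^bsub>C\<^esub> ar (Mfun T) g \<cdot>\<^bsub>C\<^esub> f, Z)),
     TensorO = TensorO C,
     TensorA = (\<lambda>(X, f, Y) (X', g, Y').
       (X \<otimes>\<^bsub>C\<^esub> X', Mlax T Y Y' \<cdot>\<^bsub>C\<^esub> (f \<boxtimes>\<^bsub>C\<^esub> g), Y \<otimes>\<^bsub>C\<^esub> Y')),
     UnitO = \<I>\<^bsub>C\<^esub>\<rparr>"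

definition kleisli_J ::
  "('o, 'a, 'm) cat_scheme \<Rightarrow> ('o, 'a) monad_data \<Rightarrow> ('o, 'a, 'o, 'o \<times> 'a \<times> 'o) fun_data" where
  "kleisli_J C T =
    \<lparr>ob = (\<lambda>X. X), ar = (\<lambda>f. (Dom C f, Munit T (Cod C f) \<cdot>\<^bsub>C\<^esub> f, Cod C f))\<rparr>"


section \<open>Categories of operators\<close>

text \<open>
  \<open>Op k n A B G\<close> for a functor \<open>G: A \<rightarrow> B\<close>.  Morphisms carry their source and target operators,
  as these are not determined by the underlying morphism of \<open>B\<close>.
\<close>

definition op_objects ::
  "nat \<Rightarrow> nat \<Rightarrow> ('o, 'a, 'm) cat_scheme \<Rightarrow> ('p, 'b, 'n) moncat_scheme
   \<Rightarrow> ('o, 'a, 'p, 'b) fun_data \<Rightarrow> ('o \<times> 'b) set" where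
  "op_objects k n A B G =
    {(X, x). X \<in> Obj A \<and> x \<in> Hom B (powO B (ob G X) k) (powO B (ob G X) n)}"

definition Op ::
  "nat \<Rightarrow> nat \<Rightarrow> ('o, 'a, 'm) cat_scheme \<Rightarrow> ('p, 'b, 'n) moncat_scheme
   \<Rightarrow> ('o, 'a, 'p, 'b) fun_data \<Rightarrow> ('o \<times> 'b, ('o \<times> 'b) \<times> 'b \<times> ('o \<times> 'b)) cat" where
  "Op k n A B G =
    \<lparr>Obj = op_objects k n A B G,
     Arr = {((X, x), h, (Y, y)).
       (X, x) \<in> op_objects k n A B G \<and> (Y, y) \<in> op_objects k n A B G \<and>
       h \<in> Hom B (ob G X) (ob G Y) \<and>
       powA B h n \<cdot>\<^bsub>B\<^esub> x = y \<cdot>\<^bsub>B\<^esub> powA B h k},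
     Dom = (\<lambda>(p, h, q). p),
     Cod = (\<lambda>(p, h, q). q),
     Ide = (\<lambda>(X, x). ((X, x), Ide B (ob G X), (X, x))),
     Comp = (\<lambda>(q, g, r) (p, f, q'). (p, g \<cdot>\<^bsub>B\<^esub> f, r))\<rparr>"

end

theory Submission
  imports Defs
begin

text \<open>
  Write \<open>P\<close>, \<open>Q\<close> and \<open>p\<close>, \<open>q\<close> for the contravariant functors of the dual equivalences of \<open>C\<close>
  and \<open>D\<close>.  A Kleisli morphism \<open>X \<rightarrow> Y\<close> is an arrow \<open>X \<rightarrow> P F q p U Q Y\<close>; by duality and the
  adjunction these correspond to the arrows \<open>U Q Y \<rightarrow> U Q X\<close> of \<open>D\<close>.  This correspondence is a
  contravariant functor \<open>\<Phi>\<close> from the Kleisli category to \<open>D\<close> that is fully faithful and strong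
  monoidal, so it turns an arrow between tensor powers of \<open>X\<close> into an arrow, in the opposite
  direction, between tensor powers of \<open>U Q X\<close>.  The induced contravariant functor on operators is
  fully faithful because \<open>\<Phi>\<close> is, and essentially surjective because an operator on \<open>A\<close> can be
  transported along the isomorphism \<open>A \<cong> Q P A\<close>.
\<close>

section \<open>Categories and contravariant functors\<close>

lemma in_Hom: "f \<in> Hom C X Y \<longleftrightarrow> f \<in> Arr C \<and> Dom C f = X \<and> Cod C f = Y"
  by (auto simp: Hom_def)

section \<open>Composition and isomorphisms in a category\<close>

context category
begin

lemma Comp_simps [simp]:
  assumes "f \<in> Arr C" "g \<in> Arr C" "Dom C g = Cod C f"
  shows "g \<cdot> f \<in> Arr C" "Dom C (g \<cdot> f) = Dom C f" "Cod C (g \<cdot> f) = Cod C g"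
  using Comp_in[of f "Dom C f" "Cod C f" g "Cod C g"] assms by (auto simp: in_Hom)

lemma Comp_assoc_simp [simp]:
  assumes "f \<in> Arr C" "g \<in> Arr C" "h \<in> Arr C" "Dom C g = Cod C f" "Dom C h = Cod C g"
  shows "(h \<cdot> g) \<cdot> f = h \<cdot> g \<cdot> f"
  using Comp_assoc[of f "Dom C f" "Cod C f" g "Cod C g" h "Cod C h"] assms by (auto simp: in_Hom)

lemma Ide_simps [simp]:
  assumes "X \<in> Obj C"
  shows "Ide C X \<in> Arr C" "Dom C (Ide C X) = X" "Cod C (Ide C X) = X"
  using Ide_in[OF assms] by (auto simp: in_Hom)

lemma Comp_Ide_simp [simp]: "f \<in> Arr C \<Longrightarrow> Dom C f = X \<Longrightarrow> f \<cdot> Ide C X = f"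
  using Comp_Ide by (auto simp: in_Hom)

lemma Ide_Comp_simp [simp]: "f \<in> Arr C \<Longrightarrow> Cod C f = X \<Longrightarrow> Ide C X \<cdot> f = f"
  using Ide_Comp by (auto simp: in_Hom)

lemmas Dom_Cod_in [simp] = Dom_in Cod_in

lemma inverse_arrows_unique:
  assumes "inverse_arrows C f g" "inverse_arrows C f h"
  shows "g = h"
proof -
  have "(g \<cdot> f) \<cdot> h = g \<cdot> (f \<cdot> h)"
    by (rule Comp_assoc_simp) (use assms in \<open>simp_all add: inverse_arrows_def in_Hom\<close>)
  then show ?thesis
    using assms by (simp add: inverse_arrows_def in_Hom)
qed

text \<open>\<open>inv_arr\<close> is a definite description; uniqueness of inverses lets any
  exhibited inverse determine its value.\<close>

lemma inv_arr_eqI: "inverse_arrows C f g \<Longrightarrow> inv_arr C f = g"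
  unfolding inv_arr_def by (rule the_equality) (auto intro: inverse_arrows_unique)

lemma inverse_arrows_inv_arr: "iso C f \<Longrightarrow> inverse_arrows C f (inv_arr C f)"
  using inv_arr_eqI unfolding iso_def by fastforce

lemma inv_arr_simps [simp]:
  assumes "iso C f"
  shows "inv_arr C f \<in> Arr C" "Dom C (inv_arr C f) = Cod C f" "Cod C (inv_arr C f) = Dom C f"
    "inv_arr C f \<cdot> f = Ide C (Dom C f)" "f \<cdot> inv_arr C f = Ide C (Cod C f)"
  using inverse_arrows_inv_arr[OF assms] by (auto simp: inverse_arrows_def in_Hom)

lemma iso_in_Arr: "iso C f \<Longrightarrow> f \<in> Arr C"
  by (auto simp: iso_def inverse_arrows_def)

text \<open>Simplification associates composites to the right, which separates a factor from its
  inverse as soon as another arrow precedes them; these forms cancel in that position.\<close>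

lemma inv_arr_cancel [simp]:
  assumes "iso C f"
  shows "g \<in> Arr C \<Longrightarrow> Cod C g = Dom C f \<Longrightarrow> inv_arr C f \<cdot> (f \<cdot> g) = g"
    "g \<in> Arr C \<Longrightarrow> Cod C g = Cod C f \<Longrightarrow> f \<cdot> (inv_arr C f \<cdot> g) = g"
  by (subst Comp_assoc_simp[symmetric]; simp add: assms iso_in_Arr)+

lemma iso_mono:
  assumes "iso C m" "f \<in> Arr C" "g \<in> Arr C" "Cod C f = Dom C m" "Cod C g = Dom C m" "m \<cdot> f = m \<cdot> g"
  shows "f = g"
  using inv_arr_cancel(1)[OF assms(1,2,4)] inv_arr_cancel(1)[OF assms(1,3,5)] assms(6)
  by metis

lemma iso_epi:
  assumes "iso C m" "f \<in> Arr C" "g \<in> Arr C" "Dom C f = Cod C m" "Dom C g = Cod C m" "f \<cdot> m = g \<cdot> m"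
  shows "f = g"
proof -
  have eq: "h = (h \<cdot> m) \<cdot> inv_arr C m" if "h \<in> Arr C" "Dom C h = Cod C m" for h
    using that assms(1) iso_in_Arr[OF assms(1)] by simp
  show ?thesis
    by (subst eq[OF assms(2,4)], subst eq[OF assms(3,5)], subst assms(6), rule refl)
qed

lemma iso_Ide: "X \<in> Obj C \<Longrightarrow> iso C (Ide C X)"
  unfolding iso_def by (rule exI[of _ "Ide C X"]) (simp add: inverse_arrows_def in_Hom)

lemma inverse_arrows_Comp:
  assumes "inverse_arrows C f f'" "inverse_arrows C g g'" "Dom C g = Cod C f"
  shows "inverse_arrows C (g \<cdot> f) (f' \<cdot> g')"
proof -
  have "g' \<cdot> (g \<cdot> f) = (g' \<cdot> g) \<cdot> f" "f \<cdot> (f' \<cdot> g') = (f \<cdot> f') \<cdot> g'"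
    by (rule Comp_assoc_simp[symmetric]; use assms in \<open>simp add: inverse_arrows_def in_Hom\<close>)+
  then show ?thesis
    using assms by (simp add: inverse_arrows_def in_Hom)
qed

lemma iso_Comp: "iso C f \<Longrightarrow> iso C g \<Longrightarrow> Dom C g = Cod C f \<Longrightarrow> iso C (g \<cdot> f)"
  using inverse_arrows_Comp unfolding iso_def by blast

lemma iso_inv_arr: "iso C f \<Longrightarrow> iso C (inv_arr C f)"
  using iso_in_Arr
  by (auto simp: iso_def[of C "inv_arr C f"] inverse_arrows_def in_Hom intro!: exI[of _ f])

lemma inv_arr_Comp:
  "iso C f \<Longrightarrow> iso C g \<Longrightarrow> Dom C g = Cod C f \<Longrightarrow> inv_arr C (g \<cdot> f) = inv_arr C f \<cdot> inv_arr C g"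
  by (intro inv_arr_eqI inverse_arrows_Comp inverse_arrows_inv_arr)

lemma inv_arr_inv_arr: "iso C f \<Longrightarrow> inv_arr C (inv_arr C f) = f"
  using iso_in_Arr by (intro inv_arr_eqI) (auto simp: inverse_arrows_def in_Hom)

lemma category_op_cat: "category (op_cat C)"
  by unfold_locales (auto simp: in_Hom op_cat_def)

end

section \<open>Covariant and contravariant functors\<close>

context is_functor
begin

lemma ar_simps [simp]:
  assumes "f \<in> Arr A"
  shows "ar F f \<in> Arr B" "Dom B (ar F f) = ob F (Dom A f)" "Cod B (ar F f) = ob F (Cod A f)"
  using ar_in[of f "Dom A f" "Cod A f"] assms by (auto simp: in_Hom)

lemma ar_Comp_simp:
  "f \<in> Arr A \<Longrightarrow> g \<in> Arr A \<Longrightarrow> Dom A g = Cod A f \<Longrightarrow> ar F (g \<cdot>\<^bsub>A\<^esub> f) = ar F g \<cdot>\<^bsub>B\<^esub> ar F f"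
  using ar_Comp by (auto simp: in_Hom)

lemma inverse_arrows_ar: "inverse_arrows A f g \<Longrightarrow> inverse_arrows B (ar F f) (ar F g)"
  by (simp add: inverse_arrows_def in_Hom ar_Comp_simp[symmetric] ar_Ide)

lemma iso_ar: "iso A f \<Longrightarrow> iso B (ar F f)"
  using inverse_arrows_ar unfolding iso_def by blast

lemma inv_arr_ar: "iso A f \<Longrightarrow> inv_arr B (ar F f) = ar F (inv_arr A f)"
  using inverse_arrows_ar A.inverse_arrows_inv_arr B.inv_arr_eqI by metis

end

text \<open>Contravariance is stated on \<open>A\<close> itself rather than on
  \<open>op_cat A\<close>, so that the simplification rules for \<open>Dom\<close>,
  \<open>Cod\<close> and composition in \<open>A\<close> apply directly.
  \<open>is_functor_op_cat\<close> and \<open>contravariant_functor_op_cat\<close> translate between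
  the two forms.\<close>

locale contravariant_functor = A: category A + B: category B
  for A :: "('o, 'a, 'm) cat_scheme" and B :: "('p, 'b, 'n) cat_scheme" +
  fixes F :: "('o, 'a, 'p, 'b) fun_data"
  assumes ob_in: "X \<in> Obj A \<Longrightarrow> ob F X \<in> Obj B"
    and ar_in: "f \<in> Hom A X Y \<Longrightarrow> ar F f \<in> Hom B (ob F Y) (ob F X)"
    and ar_Ide: "X \<in> Obj A \<Longrightarrow> ar F (Ide A X) = Ide B (ob F X)"
    and ar_Comp: "\<lbrakk>f \<in> Hom A X Y; g \<in> Hom A Y Z\<rbrakk>
      \<Longrightarrow> ar F (g \<cdot>\<^bsub>A\<^esub> f) = ar F f \<cdot>\<^bsub>B\<^esub> ar F g"
begin

lemma is_functor_op_cat: "is_functor (op_cat A) B F"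
  by (rule is_functor.intro)
    (auto simp: A.category_op_cat B.category_axioms is_functor_axioms_def Hom_op_cat op_cat_simps
      ob_in ar_in ar_Ide ar_Comp)

lemma ar_simps [simp]:
  assumes "f \<in> Arr A"
  shows "ar F f \<in> Arr B" "Dom B (ar F f) = ob F (Cod A f)" "Cod B (ar F f) = ob F (Dom A f)"
  using ar_in[of f "Dom A f" "Cod A f"] assms by (auto simp: in_Hom)

lemma ar_Comp_simp:
  "f \<in> Arr A \<Longrightarrow> g \<in> Arr A \<Longrightarrow> Dom A g = Cod A f \<Longrightarrow> ar F (g \<cdot>\<^bsub>A\<^esub> f) = ar F f \<cdot>\<^bsub>B\<^esub> ar F g"
  using ar_Comp by (auto simp: in_Hom)

lemma inverse_arrows_ar: "inverse_arrows A f g \<Longrightarrow> inverse_arrows B (ar F f) (ar F g)"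
  by (simp add: inverse_arrows_def in_Hom ar_Comp_simp[symmetric] ar_Ide)

lemma inv_arr_ar: "iso A f \<Longrightarrow> inv_arr B (ar F f) = ar F (inv_arr A f)"
  using inverse_arrows_ar A.inverse_arrows_inv_arr B.inv_arr_eqI by metis

end

lemma op_cat_op_cat [simp]: "op_cat (op_cat C) = C"
  by (simp add: op_cat_def)

lemma contravariant_functor_op_cat:
  assumes "is_functor (op_cat A) B F"
  shows "contravariant_functor A B F"
proof -
  interpret is_functor "op_cat A" B F by (rule assms)
  \<comment> \<open>The interpretation makes \<open>op_cat A\<close> a category; its opposite is
    \<open>A\<close> again.\<close>
  have "category A" using A.category_op_cat by simp
  then show ?thesis
    using ob_in ar_in ar_Ide ar_Comp B.category_axioms
    by (auto simp: contravariant_functor_def contravariant_functor_axioms_def Hom_op_cat op_cat_simps)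
qed

section \<open>A criterion for dual equivalence\<close>

lemma nat_transI:
  assumes "is_functor A B F" "is_functor A B G"
    "\<And>X. X \<in> Obj A \<Longrightarrow> \<tau> X \<in> Hom B (ob F X) (ob G X)"
    "\<And>f X Y. f \<in> Hom A X Y \<Longrightarrow> \<tau> Y \<cdot>\<^bsub>B\<^esub> ar F f = ar G f \<cdot>\<^bsub>B\<^esub> \<tau> X"
  shows "nat_trans A B F G \<tau>"
  using assms by (auto simp: nat_trans_def nat_trans_axioms_def)

lemma is_functor_fun_id: "category A \<Longrightarrow> is_functor A A fun_id"
  by (auto simp: is_functor_def is_functor_axioms_def fun_id_def)

lemma is_functor_fun_comp_contravariant:
  assumes "contravariant_functor A B F" "contravariant_functor B A' G"
  shows "is_functor A A' (G \<circ>\<^sub>F F)"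
proof -
  interpret F: contravariant_functor A B F by (rule assms)
  interpret G: contravariant_functor B A' G by (rule assms)
  show ?thesis
    by unfold_locales
      (auto simp: fun_comp_def in_Hom F.ob_in G.ob_in F.ar_Ide G.ar_Ide F.ar_Comp_simp G.ar_Comp_simp)
qed

text \<open>The usual quasi-inverse: choose for each \<open>Z\<close> an object whose image is
  isomorphic to \<open>Z\<close>, and lift conjugated arrows by fullness. Equations in
  \<open>B\<close> are checked after applying the faithful \<open>G\<close>. As \<open>G\<close>
  runs from \<open>B\<close> to \<open>A\<close>, it becomes \<open>cohat\<close>, and the
  constructed functor becomes \<open>hat\<close>.\<close>

theorem dually_equivalentI:
  assumes "contravariant_functor B A G"
    and faithful: "\<And>X Y f g. \<lbrakk>f \<in> Hom B X Y; g \<in> Hom B X Y; ar G f = ar G g\<rbrakk> \<Longrightarrow> f = g"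
    and full: "\<And>X Y h. \<lbrakk>X \<in> Obj B; Y \<in> Obj B; h \<in> Hom A (ob G Y) (ob G X)\<rbrakk>
      \<Longrightarrow> \<exists>f \<in> Hom B X Y. ar G f = h"
    and ess_surj: "\<And>Z. Z \<in> Obj A \<Longrightarrow> \<exists>X \<in> Obj B. \<exists>f \<in> Hom A Z (ob G X). iso A f"
  shows "dually_equivalent A B"
proof -
  interpret G: contravariant_functor B A G by (rule assms)
  from ess_surj obtain S \<psi> where
    S [simp]: "\<And>Z. Z \<in> Obj A \<Longrightarrow> S Z \<in> Obj B"
    and \<psi>_Hom: "\<And>Z. Z \<in> Obj A \<Longrightarrow> \<psi> Z \<in> Hom A Z (ob G (S Z))"
    and \<psi>_iso [simp]: "\<And>Z. Z \<in> Obj A \<Longrightarrow> iso A (\<psi> Z)"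
    by metis
  have \<psi> [simp]: "\<psi> Z \<in> Arr A" "Dom A (\<psi> Z) = Z" "Cod A (\<psi> Z) = ob G (S Z)"
    if "Z \<in> Obj A" for Z
    using \<psi>_Hom[OF that] by (auto simp: in_Hom)
  note [simp] = G.ob_in G.ar_Ide
  have faithful': "f = g" if "f \<in> Arr B" "g \<in> Arr B" "Dom B f = Dom B g" "Cod B f = Cod B g"
    "ar G f = ar G g" for f g
    using faithful[of f "Dom B f" "Cod B f" g] that by (simp add: in_Hom)
  \<comment> \<open>A choice of preimage under \<open>G\<close>, available by fullness and unique by
    faithfulness.\<close>
  define \<phi> where "\<phi> X Y h = (SOME f. f \<in> Hom B X Y \<and> ar G f = h)" for X Y h
  have \<phi>: "\<phi> X Y h \<in> Hom B X Y \<and> ar G (\<phi> X Y h) = h"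
    if "X \<in> Obj B" "Y \<in> Obj B" "h \<in> Arr A" "Dom A h = ob G Y" "Cod A h = ob G X" for X Y h
    unfolding \<phi>_def by (rule someI_ex) (use full[of X Y h] that in \<open>auto simp: in_Hom\<close>)
  have \<phi>_simps [simp]: "\<phi> X Y h \<in> Arr B" "Dom B (\<phi> X Y h) = X" "Cod B (\<phi> X Y h) = Y"
    "ar G (\<phi> X Y h) = h"
    if "X \<in> Obj B" "Y \<in> Obj B" "h \<in> Arr A" "Dom A h = ob G Y" "Cod A h = ob G X" for X Y h
    using \<phi>[OF that] by (auto simp: in_Hom)
  define H where "H = \<lparr>ob = S, ar = (\<lambda>f. \<phi> (S (Cod A f)) (S (Dom A f))
    (\<psi> (Cod A f) \<cdot>\<^bsub>A\<^esub> f \<cdot>\<^bsub>A\<^esub> inv_arr A (\<psi> (Dom A f))))\<rparr>"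
  have obH [simp]: "ob H = S" by (simp add: H_def)
  have arH: "ar H f \<in> Arr B" "Dom B (ar H f) = S (Cod A f)" "Cod B (ar H f) = S (Dom A f)"
    "ar G (ar H f) = \<psi> (Cod A f) \<cdot>\<^bsub>A\<^esub> f \<cdot>\<^bsub>A\<^esub> inv_arr A (\<psi> (Dom A f))" if "f \<in> Arr A" for f
    using that by (auto simp: H_def)
  interpret H: contravariant_functor A B H
    by unfold_locales
      (auto simp: in_Hom arH G.ar_Comp_simp intro!: faithful')
  \<comment> \<open>\<open>G\<close> reverses arrows, so a component \<open>X -> S (ob G X)\<close>
    must lift an arrow \<open>ob G (S (ob G X)) -> ob G X\<close>, which is the inverse of
    \<open>\<psi>\<close>.\<close>
  define \<theta> where "\<theta> X = \<phi> X (S (ob G X)) (inv_arr A (\<psi> (ob G X)))" for X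
  have \<theta> [simp]: "\<theta> X \<in> Arr B" "Dom B (\<theta> X) = X" "Cod B (\<theta> X) = S (ob G X)"
    "ar G (\<theta> X) = inv_arr A (\<psi> (ob G X))" if "X \<in> Obj B" for X
    using that by (auto simp: \<theta>_def)
  have \<theta>_iso: "iso B (\<theta> X)" if "X \<in> Obj B" for X
  proof -
    have "inverse_arrows B (\<theta> X) (\<phi> (S (ob G X)) X (\<psi> (ob G X)))"
      using that by (auto simp: inverse_arrows_def in_Hom G.ar_Comp_simp intro!: faithful')
    then show ?thesis by (auto simp: iso_def)
  qed
  define d where "d = \<lparr>hat = H, cohat = G, hat_iso = \<theta>, cohat_iso = \<psi>\<rparr>"
  have "nat_trans A A fun_id (G \<circ>\<^sub>F H) \<psi>"
    using is_functor_fun_id[OF G.B.category_axioms]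
      is_functor_fun_comp_contravariant[OF H.contravariant_functor_axioms assms(1)]
    by (rule nat_transI) (auto simp: fun_comp_def fun_id_def in_Hom arH)
  moreover have "nat_trans B B fun_id (H \<circ>\<^sub>F G) \<theta>"
    using is_functor_fun_id[OF G.A.category_axioms]
      is_functor_fun_comp_contravariant[OF assms(1) H.contravariant_functor_axioms]
    by (rule nat_transI)
      (auto simp: fun_comp_def fun_id_def in_Hom arH G.ar_Comp_simp intro!: faithful')
  ultimately have "dual_equivalence A B d"
    using H.is_functor_op_cat G.is_functor_op_cat \<theta>_iso
    by (auto simp: dual_equivalence_def d_def nat_iso_def nat_iso_axioms_def)
  then show ?thesis
    by (auto simp: dually_equivalent_def)
qed

section \<open>Tensor powers and operators\<close>

text \<open>Common ground for the strict \<open>D\<close> and for the Kleisli category, whose tensor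
  passes through double duals: a functorial tensor is what tensor powers and operators are built
  on.\<close>

locale tensor_category = category C
  for C :: "('o, 'a, 'm) moncat_scheme" (structure) +
  assumes TensorO_in: "\<lbrakk>X \<in> Obj C; Y \<in> Obj C\<rbrakk> \<Longrightarrow> X \<otimes> Y \<in> Obj C"
    and TensorA_in: "\<lbrakk>f \<in> Hom C X Y; g \<in> Hom C X' Y'\<rbrakk>
      \<Longrightarrow> f \<boxtimes> g \<in> Hom C (X \<otimes> X') (Y \<otimes> Y')"
    and UnitO_in: "\<I> \<in> Obj C"
    and TensorA_Ide: "\<lbrakk>X \<in> Obj C; Y \<in> Obj C\<rbrakk> \<Longrightarrow> Ide C X \<boxtimes> Ide C Y = Ide C (X \<otimes> Y)"
    and TensorA_Comp: "\<lbrakk>f \<in> Hom C X Y; g \<in> Hom C Y Z; f' \<in> Hom C X' Y'; g' \<in> Hom C Y' Z'\<rbrakk>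
      \<Longrightarrow> (g \<cdot> f) \<boxtimes> (g' \<cdot> f') = (g \<boxtimes> g') \<cdot> (f \<boxtimes> f')"
begin

declare TensorO_in [simp] UnitO_in [simp] TensorA_Ide [simp]

lemma TensorA_simps [simp]:
  assumes "f \<in> Arr C" "g \<in> Arr C"
  shows "f \<boxtimes> g \<in> Arr C" "Dom C (f \<boxtimes> g) = Dom C f \<otimes> Dom C g" "Cod C (f \<boxtimes> g) = Cod C f \<otimes> Cod C g"
  using TensorA_in[of f "Dom C f" "Cod C f" g "Dom C g" "Cod C g"] assms by (auto simp: in_Hom)

text \<open>Oriented so that composites of tensors merge into one tensor; the second form serves
  composites already associated to the right.\<close>

lemma interchange [simp]:
  assumes "f \<in> Arr C" "g \<in> Arr C" "f' \<in> Arr C" "g' \<in> Arr C" "Dom C g = Cod C f" "Dom C g' = Cod C f'"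
  shows "(g \<boxtimes> g') \<cdot> (f \<boxtimes> f') = (g \<cdot> f) \<boxtimes> (g' \<cdot> f')"
    and "h \<in> Arr C \<Longrightarrow> Cod C h = Dom C f \<otimes> Dom C f' \<Longrightarrow>
      (g \<boxtimes> g') \<cdot> ((f \<boxtimes> f') \<cdot> h) = ((g \<cdot> f) \<boxtimes> (g' \<cdot> f')) \<cdot> h"
proof -
  show *: "(g \<boxtimes> g') \<cdot> (f \<boxtimes> f') = (g \<cdot> f) \<boxtimes> (g' \<cdot> f')"
    by (rule TensorA_Comp[symmetric]) (use assms in \<open>auto simp: in_Hom\<close>)
  assume "h \<in> Arr C" "Cod C h = Dom C f \<otimes> Dom C f'"
  then have "(g \<boxtimes> g') \<cdot> ((f \<boxtimes> f') \<cdot> h) = ((g \<boxtimes> g') \<cdot> (f \<boxtimes> f')) \<cdot> h"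
    by (intro Comp_assoc_simp[symmetric]) (use assms in auto)
  then show "(g \<boxtimes> g') \<cdot> ((f \<boxtimes> f') \<cdot> h) = ((g \<cdot> f) \<boxtimes> (g' \<cdot> f')) \<cdot> h"
    by (simp only: *)
qed

lemma inverse_arrows_TensorA:
  "inverse_arrows C f f' \<Longrightarrow> inverse_arrows C g g' \<Longrightarrow> inverse_arrows C (f \<boxtimes> g) (f' \<boxtimes> g')"
  by (simp add: inverse_arrows_def in_Hom)

lemma iso_TensorA: "iso C f \<Longrightarrow> iso C g \<Longrightarrow> iso C (f \<boxtimes> g)"
  using inverse_arrows_TensorA unfolding iso_def by blast

lemma inv_arr_TensorA:
  "iso C f \<Longrightarrow> iso C g \<Longrightarrow> inv_arr C (f \<boxtimes> g) = inv_arr C f \<boxtimes> inv_arr C g"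
  by (intro inv_arr_eqI inverse_arrows_TensorA inverse_arrows_inv_arr)

lemma powO_in [simp]: "X \<in> Obj C \<Longrightarrow> powO C X n \<in> Obj C"
  \<comment> \<open>The induction has the three cases of \<open>powO\<close>, where the first power
    is \<open>X\<close> itself and not \<open>X\<close> tensored with the unit.\<close>
  by (induction n rule: induct_nat_012) auto

lemma powA_simps [simp]:
  assumes "f \<in> Arr C"
  shows "powA C f n \<in> Arr C" "Dom C (powA C f n) = powO C (Dom C f) n"
    "Cod C (powA C f n) = powO C (Cod C f) n"
  using assms by (induction n rule: induct_nat_012) auto

lemma powA_Ide: "X \<in> Obj C \<Longrightarrow> powA C (Ide C X) n = Ide C (powO C X n)"
  by (induction n rule: induct_nat_012) auto

lemma powA_Comp:
  "f \<in> Arr C \<Longrightarrow> g \<in> Arr C \<Longrightarrow> Dom C g = Cod C f \<Longrightarrow>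
    powA C (g \<cdot> f) n = powA C g n \<cdot> powA C f n"
  by (induction n rule: induct_nat_012) auto

lemma inverse_arrows_powA: "inverse_arrows C f g \<Longrightarrow> inverse_arrows C (powA C f n) (powA C g n)"
  by (simp add: inverse_arrows_def in_Hom powA_Comp[symmetric] powA_Ide)

end

lemma (in strict_monoidal) tensor_category: "tensor_category C"
  by unfold_locales (rule TensorO_in TensorA_in UnitO_in TensorA_Ide TensorA_Comp; assumption)+

text \<open>The square is hidden behind a name so that simplification of membership in
  \<open>Op\<close> treats it as one atom and does not rewrite its two sides.\<close>

definition operator_morphism ::
  "nat \<Rightarrow> nat \<Rightarrow> ('p, 'b, 'n) moncat_scheme \<Rightarrow> 'b \<Rightarrow> 'b \<Rightarrow> 'b \<Rightarrow> bool" where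
  "operator_morphism k n B x y h \<longleftrightarrow> powA B h n \<cdot>\<^bsub>B\<^esub> x = y \<cdot>\<^bsub>B\<^esub> powA B h k"

lemma Op_simps [simp]:
  "Obj (Op k n A B G) = op_objects k n A B G"
  "(p, h, q) \<in> Arr (Op k n A B G) \<longleftrightarrow> p \<in> op_objects k n A B G \<and> q \<in> op_objects k n A B G \<and>
    h \<in> Hom B (ob G (fst p)) (ob G (fst q)) \<and> operator_morphism k n B (snd p) (snd q) h"
  "Dom (Op k n A B G) (p, h, q) = p"
  "Cod (Op k n A B G) (p, h, q) = q"
  "Ide (Op k n A B G) p = (p, Ide B (ob G (fst p)), p)"
  "(q, g, r) \<cdot>\<^bsub>Op k n A B G\<^esub> (p, f, q') = (p, g \<cdot>\<^bsub>B\<^esub> f, r)"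
  by (auto simp: Op_def operator_morphism_def split: prod.splits)

lemma op_objects_iff [simp]:
  "p \<in> op_objects k n A B G \<longleftrightarrow> fst p \<in> Obj A \<and> snd p \<in> Arr B \<and>
    Dom B (snd p) = powO B (ob G (fst p)) k \<and> Cod B (snd p) = powO B (ob G (fst p)) n"
  by (cases p) (auto simp: op_objects_def in_Hom)

section \<open>The category of operators\<close>

context tensor_category
begin

lemma operator_morphism_Ide:
  assumes "X \<in> Obj C" "x \<in> Hom C (powO C X k) (powO C X n)"
  shows "operator_morphism k n C x x (Ide C X)"
  using assms by (auto simp: operator_morphism_def powA_Ide in_Hom)

text \<open>The two squares are pasted along \<open>y\<close>, since tensor powers preserve
  composition.\<close>

lemma operator_morphism_Comp:
  assumes "f \<in> Hom C X Y" "g \<in> Hom C Y Z"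
    and "x \<in> Hom C (powO C X k) (powO C X n)" "y \<in> Hom C (powO C Y k) (powO C Y n)"
      "z \<in> Hom C (powO C Z k) (powO C Z n)"
    and f: "operator_morphism k n C x y f" and g: "operator_morphism k n C y z g"
  shows "operator_morphism k n C x z (g \<cdot> f)"
proof -
  have "powA C (g \<cdot> f) n \<cdot> x = powA C g n \<cdot> (powA C f n \<cdot> x)"
    using assms(1-5) by (auto simp: in_Hom powA_Comp)
  also have "\<dots> = (powA C g n \<cdot> y) \<cdot> powA C f k"
    using assms(1-5) f by (auto simp: in_Hom operator_morphism_def)
  also have "\<dots> = z \<cdot> powA C (g \<cdot> f) k"
    using assms(1-5) g by (auto simp: in_Hom operator_morphism_def powA_Comp)
  finally show ?thesis by (simp add: operator_morphism_def)
qed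

text \<open>Tensor powers preserve inverses, so the square of \<open>h\<close> can be surrounded by
  powers of \<open>h'\<close>. Hence an operator morphism is invertible in \<open>Op\<close> as soon
  as its underlying arrow is invertible.\<close>

lemma operator_morphism_inverse:
  assumes "inverse_arrows C h h'" "h \<in> Hom C X Y"
    and "x \<in> Hom C (powO C X k) (powO C X n)" "y \<in> Hom C (powO C Y k) (powO C Y n)"
    and "operator_morphism k n C x y h"
  shows "operator_morphism k n C y x h'"
proof -
  have inv: "powA C h' k' \<cdot> powA C h k' = Ide C (powO C X k')"
    "powA C h k' \<cdot> powA C h' k' = Ide C (powO C Y k')" for k'
    using inverse_arrows_powA[OF assms(1), of k'] assms(2) by (auto simp: inverse_arrows_def in_Hom)
  have h': "h' \<in> Arr C" "Dom C h' = Y" "Cod C h' = X"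
    using assms(1,2) by (auto simp: inverse_arrows_def in_Hom)
  have "powA C h' n \<cdot> y = powA C h' n \<cdot> (y \<cdot> powA C h k) \<cdot> powA C h' k"
    using assms(2-4) h' by (simp add: in_Hom inv)
  also have "\<dots> = powA C h' n \<cdot> (powA C h n \<cdot> x) \<cdot> powA C h' k"
    using assms(5) by (simp add: operator_morphism_def)
  also have "\<dots> = (powA C h' n \<cdot> powA C h n) \<cdot> x \<cdot> powA C h' k"
    using assms(2-4) h' by (simp add: in_Hom)
  also have "\<dots> = x \<cdot> powA C h' k"
    unfolding inv using assms(2-4) h' by (simp add: in_Hom)
  finally show ?thesis by (simp add: operator_morphism_def)
qed

text \<open>\<open>Op\<close> sees \<open>G\<close> through its object map alone, hence the form of
  the assumption.\<close>

lemma category_Op: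
  assumes "\<And>X. X \<in> Obj A \<Longrightarrow> ob G X \<in> Obj C"
  shows "category (Op k n A C G)"
proof
  fix f assume "f \<in> Arr (Op k n A C G)"
  then show "Dom (Op k n A C G) f \<in> Obj (Op k n A C G)" "Cod (Op k n A C G) f \<in> Obj (Op k n A C G)"
    by (cases f; simp)+
next
  fix p assume "p \<in> Obj (Op k n A C G)"
  then show "Ide (Op k n A C G) p \<in> Hom (Op k n A C G) p p"
    using operator_morphism_Ide[of "ob G (fst p)" "snd p" k n] by (simp add: in_Hom assms)
next
  fix f g p q r assume f: "f \<in> Hom (Op k n A C G) p q" and g: "g \<in> Hom (Op k n A C G) q r"
  obtain f' g' where [simp]: "f = (p, f', q)" "g = (q, g', r)"
    using f g by (cases f; cases g) (simp add: in_Hom)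
  show "g \<cdot>\<^bsub>Op k n A C G\<^esub> f \<in> Hom (Op k n A C G) p r"
    using f g operator_morphism_Comp[of f' "ob G (fst p)" "ob G (fst q)" g' "ob G (fst r)"
        "snd p" k n "snd q" "snd r"]
    by (simp add: in_Hom)
next
  fix f p q assume f: "f \<in> Hom (Op k n A C G) p q"
  then show "f \<cdot>\<^bsub>Op k n A C G\<^esub> Ide (Op k n A C G) p = f" "Ide (Op k n A C G) q \<cdot>\<^bsub>Op k n A C G\<^esub> f = f"
    by (cases f; simp add: in_Hom)+
next
  fix f g h p q r t
  assume "f \<in> Hom (Op k n A C G) t p" "g \<in> Hom (Op k n A C G) p q" "h \<in> Hom (Op k n A C G) q r"
  then show "(h \<cdot>\<^bsub>Op k n A C G\<^esub> g) \<cdot>\<^bsub>Op k n A C G\<^esub> f = h \<cdot>\<^bsub>Op k n A C G\<^esub> (g \<cdot>\<^bsub>Op k n A C G\<^esub> f)"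
    by (cases f; cases g; cases h; simp add: in_Hom)
qed

lemma inverse_arrows_Op:
  assumes "(p, h, q) \<in> Arr (Op k n A C G)" "inverse_arrows C h h'"
  shows "inverse_arrows (Op k n A C G) (p, h, q) (q, h', p)"
  using assms operator_morphism_inverse[OF assms(2), of _ _ "snd p" k n "snd q"]
  by (auto simp: inverse_arrows_def in_Hom)

end

section \<open>Strong monoidal contravariant embeddings\<close>

text \<open>The assumptions on \<open>K\<close> alone say that its operations are well typed; its
  equational laws follow in \<open>category_K\<close> and \<open>tensor_category_K\<close>. For the
  Kleisli category this takes the place of checking the monad laws one by one.\<close>

locale contravariant_embedding = D: tensor_category D
  for D :: "('p, 'b, 'n) moncat_scheme" +
  fixes K :: "('o, 'a, 'm) moncat_scheme" and \<Phi> :: "('o, 'a, 'p, 'b) fun_data"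
    and m :: "'o \<Rightarrow> 'o \<Rightarrow> 'b" and e :: 'b
  assumes K_Dom_in: "f \<in> Arr K \<Longrightarrow> Dom K f \<in> Obj K"
    and K_Cod_in: "f \<in> Arr K \<Longrightarrow> Cod K f \<in> Obj K"
    and K_Ide_in: "X \<in> Obj K \<Longrightarrow> Ide K X \<in> Hom K X X"
    and K_Comp_in: "\<lbrakk>f \<in> Hom K X Y; g \<in> Hom K Y Z\<rbrakk> \<Longrightarrow> g \<cdot>\<^bsub>K\<^esub> f \<in> Hom K X Z"
    and K_TensorO_in: "\<lbrakk>X \<in> Obj K; Y \<in> Obj K\<rbrakk> \<Longrightarrow> X \<otimes>\<^bsub>K\<^esub> Y \<in> Obj K"
    and K_TensorA_in: "\<lbrakk>f \<in> Hom K X Y; g \<in> Hom K X' Y'\<rbrakk>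
      \<Longrightarrow> f \<boxtimes>\<^bsub>K\<^esub> g \<in> Hom K (X \<otimes>\<^bsub>K\<^esub> X') (Y \<otimes>\<^bsub>K\<^esub> Y')"
    and K_UnitO_in: "\<I>\<^bsub>K\<^esub> \<in> Obj K"
    and \<Phi>_ob_in: "X \<in> Obj K \<Longrightarrow> ob \<Phi> X \<in> Obj D"
    and \<Phi>_ar_in: "f \<in> Hom K X Y \<Longrightarrow> ar \<Phi> f \<in> Hom D (ob \<Phi> Y) (ob \<Phi> X)"
    and \<Phi>_Ide: "X \<in> Obj K \<Longrightarrow> ar \<Phi> (Ide K X) = Ide D (ob \<Phi> X)"
    and \<Phi>_Comp: "\<lbrakk>f \<in> Hom K X Y; g \<in> Hom K Y Z\<rbrakk>
      \<Longrightarrow> ar \<Phi> (g \<cdot>\<^bsub>K\<^esub> f) = ar \<Phi> f \<cdot>\<^bsub>D\<^esub> ar \<Phi> g"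
    and faithful: "\<lbrakk>f \<in> Hom K X Y; g \<in> Hom K X Y; ar \<Phi> f = ar \<Phi> g\<rbrakk> \<Longrightarrow> f = g"
    and full: "\<lbrakk>X \<in> Obj K; Y \<in> Obj K; h \<in> Hom D (ob \<Phi> Y) (ob \<Phi> X)\<rbrakk>
      \<Longrightarrow> \<exists>f \<in> Hom K X Y. ar \<Phi> f = h"
    and m_in: "\<lbrakk>X \<in> Obj K; Y \<in> Obj K\<rbrakk>
      \<Longrightarrow> m X Y \<in> Hom D (ob \<Phi> X \<otimes>\<^bsub>D\<^esub> ob \<Phi> Y) (ob \<Phi> (X \<otimes>\<^bsub>K\<^esub> Y))"
    and m_iso: "\<lbrakk>X \<in> Obj K; Y \<in> Obj K\<rbrakk> \<Longrightarrow> iso D (m X Y)"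
    and m_natural: "\<lbrakk>f \<in> Hom K X Y; f' \<in> Hom K X' Y'\<rbrakk>
      \<Longrightarrow> ar \<Phi> (f \<boxtimes>\<^bsub>K\<^esub> f') \<cdot>\<^bsub>D\<^esub> m Y Y' = m X X' \<cdot>\<^bsub>D\<^esub> (ar \<Phi> f \<boxtimes>\<^bsub>D\<^esub> ar \<Phi> f')"
    and e_in: "e \<in> Hom D \<I>\<^bsub>D\<^esub> (ob \<Phi> \<I>\<^bsub>K\<^esub>)"
    and e_iso: "iso D e"
begin

text \<open>That \<open>K\<close> is a category with functorial tensor is inherited along the faithful \<open>\<Phi>\<close>.\<close>

lemma category_K: "category K"
proof
  fix f X Y assume f: "f \<in> Hom K X Y"
  then have X: "X \<in> Obj K" and Y: "Y \<in> Obj K"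
    using K_Dom_in K_Cod_in by (auto simp: in_Hom)
  show "f \<cdot>\<^bsub>K\<^esub> Ide K X = f"
    by (rule faithful[OF K_Comp_in[OF K_Ide_in[OF X] f] f])
      (use \<Phi>_ar_in[OF f] in \<open>auto simp: \<Phi>_Comp[OF K_Ide_in[OF X] f] \<Phi>_Ide[OF X] in_Hom\<close>)
  show "Ide K Y \<cdot>\<^bsub>K\<^esub> f = f"
    by (rule faithful[OF K_Comp_in[OF f K_Ide_in[OF Y]] f])
      (use \<Phi>_ar_in[OF f] in \<open>auto simp: \<Phi>_Comp[OF f K_Ide_in[OF Y]] \<Phi>_Ide[OF Y] in_Hom\<close>)
next
  fix f g h W X Y Z assume f: "f \<in> Hom K W X" and g: "g \<in> Hom K X Y" and h: "h \<in> Hom K Y Z"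
  note gf = K_Comp_in[OF f g] and hg = K_Comp_in[OF g h]
  show "(h \<cdot>\<^bsub>K\<^esub> g) \<cdot>\<^bsub>K\<^esub> f = h \<cdot>\<^bsub>K\<^esub> (g \<cdot>\<^bsub>K\<^esub> f)"
    by (rule faithful[OF K_Comp_in[OF f hg] K_Comp_in[OF gf h]])
      (use \<Phi>_ar_in[OF f] \<Phi>_ar_in[OF g] \<Phi>_ar_in[OF h] in
        \<open>auto simp: \<Phi>_Comp[OF f hg] \<Phi>_Comp[OF gf h] \<Phi>_Comp[OF f g] \<Phi>_Comp[OF g h] in_Hom\<close>)
qed (simp_all add: K_Dom_in K_Cod_in K_Ide_in K_Comp_in)

sublocale \<Phi>: contravariant_functor K D \<Phi>
  by (rule contravariant_functor.intro)
    (auto simp: category_K D.category_axioms contravariant_functor_axioms_def \<Phi>_ob_in \<Phi>_ar_in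
      \<Phi>_Ide \<Phi>_Comp)

declare \<Phi>_ob_in [simp] \<Phi>_Ide [simp]

lemma m_simps [simp]:
  assumes "X \<in> Obj K" "Y \<in> Obj K"
  shows "m X Y \<in> Arr D" "Dom D (m X Y) = ob \<Phi> X \<otimes>\<^bsub>D\<^esub> ob \<Phi> Y"
    "Cod D (m X Y) = ob \<Phi> (X \<otimes>\<^bsub>K\<^esub> Y)" "iso D (m X Y)"
  using m_in[OF assms] m_iso[OF assms] by (auto simp: in_Hom)

lemma e_simps [simp]:
  "e \<in> Arr D" "Dom D e = \<I>\<^bsub>D\<^esub>" "Cod D e = ob \<Phi> \<I>\<^bsub>K\<^esub>" "iso D e"
  using e_in e_iso by (auto simp: in_Hom)

lemma faithful_Arr:
  "\<lbrakk>f \<in> Arr K; g \<in> Arr K; Dom K f = Dom K g; Cod K f = Cod K g; ar \<Phi> f = ar \<Phi> g\<rbrakk> \<Longrightarrow> f = g"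
  using faithful[of f "Dom K f" "Cod K f" g] by (simp add: in_Hom)

lemma K_TensorA_simps:
  assumes "f \<in> Arr K" "g \<in> Arr K"
  shows "f \<boxtimes>\<^bsub>K\<^esub> g \<in> Arr K" "Dom K (f \<boxtimes>\<^bsub>K\<^esub> g) = Dom K f \<otimes>\<^bsub>K\<^esub> Dom K g"
    "Cod K (f \<boxtimes>\<^bsub>K\<^esub> g) = Cod K f \<otimes>\<^bsub>K\<^esub> Cod K g"
  using K_TensorA_in[of f "Dom K f" "Cod K f" g "Dom K g" "Cod K g"] assms by (auto simp: in_Hom)

lemma ar_TensorA:
  assumes "f \<in> Arr K" "g \<in> Arr K"
  shows "ar \<Phi> (f \<boxtimes>\<^bsub>K\<^esub> g) \<cdot>\<^bsub>D\<^esub> m (Cod K f) (Cod K g)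
    = m (Dom K f) (Dom K g) \<cdot>\<^bsub>D\<^esub> (ar \<Phi> f \<boxtimes>\<^bsub>D\<^esub> ar \<Phi> g)"
  using m_natural assms by (simp add: in_Hom)

lemma tensor_category_K: "tensor_category K"
proof (rule tensor_category.intro[OF category_K], unfold_locales)
  fix X Y assume XY [simp]: "X \<in> Obj K" "Y \<in> Obj K"
  note [simp] = K_TensorA_simps K_TensorO_in
  \<comment> \<open>The isomorphism \<open>m\<close> can be cancelled on the right, so
    \<open>ar_TensorA\<close> determines the image of a tensor of arrows.\<close>
  have "ar \<Phi> (Ide K X \<boxtimes>\<^bsub>K\<^esub> Ide K Y) = ar \<Phi> (Ide K (X \<otimes>\<^bsub>K\<^esub> Y))"
    by (rule D.iso_epi[OF m_iso[OF XY]]) (use ar_TensorA[of "Ide K X" "Ide K Y"] in auto)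
  then show "Ide K X \<boxtimes>\<^bsub>K\<^esub> Ide K Y = Ide K (X \<otimes>\<^bsub>K\<^esub> Y)"
    by (intro faithful_Arr) auto
next
  fix f g f' g' X Y Z X' Y' Z'
  assume "f \<in> Hom K X Y" "g \<in> Hom K Y Z" "f' \<in> Hom K X' Y'" "g' \<in> Hom K Y' Z'"
  then have [simp]: "f \<in> Arr K" "Dom K f = X" "Cod K f = Y" "g \<in> Arr K" "Dom K g = Y" "Cod K g = Z"
    "f' \<in> Arr K" "Dom K f' = X'" "Cod K f' = Y'" "g' \<in> Arr K" "Dom K g' = Y'" "Cod K g' = Z'"
    and [simp]: "X \<in> Obj K" "Y \<in> Obj K" "Z \<in> Obj K" "X' \<in> Obj K" "Y' \<in> Obj K" "Z' \<in> Obj K"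
    using K_Dom_in K_Cod_in by (auto simp: in_Hom)
  note [simp] = K_TensorA_simps K_TensorO_in \<Phi>.ar_Comp_simp
  have 1: "ar \<Phi> (f \<boxtimes>\<^bsub>K\<^esub> f') \<cdot>\<^bsub>D\<^esub> m Y Y' = m X X' \<cdot>\<^bsub>D\<^esub> (ar \<Phi> f \<boxtimes>\<^bsub>D\<^esub> ar \<Phi> f')"
    using ar_TensorA[of f f'] by simp
  have "(ar \<Phi> (f \<boxtimes>\<^bsub>K\<^esub> f') \<cdot>\<^bsub>D\<^esub> ar \<Phi> (g \<boxtimes>\<^bsub>K\<^esub> g')) \<cdot>\<^bsub>D\<^esub> m Z Z'
    = ar \<Phi> (f \<boxtimes>\<^bsub>K\<^esub> f') \<cdot>\<^bsub>D\<^esub> m Y Y' \<cdot>\<^bsub>D\<^esub> (ar \<Phi> g \<boxtimes>\<^bsub>D\<^esub> ar \<Phi> g')"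
    using ar_TensorA[of g g'] by simp
  also have "\<dots> = (ar \<Phi> (f \<boxtimes>\<^bsub>K\<^esub> f') \<cdot>\<^bsub>D\<^esub> m Y Y') \<cdot>\<^bsub>D\<^esub> (ar \<Phi> g \<boxtimes>\<^bsub>D\<^esub> ar \<Phi> g')"
    by simp
  also have "\<dots> = ar \<Phi> ((g \<cdot>\<^bsub>K\<^esub> f) \<boxtimes>\<^bsub>K\<^esub> (g' \<cdot>\<^bsub>K\<^esub> f')) \<cdot>\<^bsub>D\<^esub> m Z Z'"
    unfolding 1 using ar_TensorA[of "g \<cdot>\<^bsub>K\<^esub> f" "g' \<cdot>\<^bsub>K\<^esub> f'"] by simp
  finally have "ar \<Phi> (f \<boxtimes>\<^bsub>K\<^esub> f') \<cdot>\<^bsub>D\<^esub> ar \<Phi> (g \<boxtimes>\<^bsub>K\<^esub> g')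
    = ar \<Phi> ((g \<cdot>\<^bsub>K\<^esub> f) \<boxtimes>\<^bsub>K\<^esub> (g' \<cdot>\<^bsub>K\<^esub> f'))"
    by (rule D.iso_epi[OF m_iso, rotated -1]) auto
  then show "(g \<cdot>\<^bsub>K\<^esub> f) \<boxtimes>\<^bsub>K\<^esub> (g' \<cdot>\<^bsub>K\<^esub> f') = (g \<boxtimes>\<^bsub>K\<^esub> g') \<cdot>\<^bsub>K\<^esub> (f \<boxtimes>\<^bsub>K\<^esub> f')"
    by (intro faithful_Arr) auto
qed (simp_all add: K_TensorO_in K_UnitO_in K_TensorA_in)

section \<open>Comparison of tensor powers along \<open>\<Phi>\<close>\<close>

sublocale K: tensor_category K
  by (rule tensor_category_K)

text \<open>The canonical isomorphism from the \<open>n\<close>-th power of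
  \<open>ob \<Phi> X\<close> to the image of the \<open>n\<close>-th power of \<open>X\<close>. Its
  cases mirror \<open>powO\<close>, so the first power takes an identity and involves neither
  \<open>m\<close> nor \<open>e\<close>.\<close>

fun \<theta> :: "'o \<Rightarrow> nat \<Rightarrow> 'b" where
  "\<theta> X 0 = e"
| "\<theta> X (Suc 0) = Ide D (ob \<Phi> X)"
| "\<theta> X (Suc (Suc n)) = m X (powO K X (Suc n)) \<cdot>\<^bsub>D\<^esub> (Ide D (ob \<Phi> X) \<boxtimes>\<^bsub>D\<^esub> \<theta> X (Suc n))"

lemma \<theta>_simps [simp]:
  assumes "X \<in> Obj K"
  shows "\<theta> X n \<in> Arr D" "Dom D (\<theta> X n) = powO D (ob \<Phi> X) n" "Cod D (\<theta> X n) = ob \<Phi> (powO K X n)"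
  using assms by (induction n rule: induct_nat_012) auto

lemma \<theta>_iso [simp]: "X \<in> Obj K \<Longrightarrow> iso D (\<theta> X n)"
  by (induction n rule: induct_nat_012)
    (auto simp: D.iso_Ide intro!: D.iso_Comp D.iso_TensorA)

text \<open>By induction: \<open>ar_TensorA\<close> moves the image of a tensor past
  \<open>m\<close>, and the hypothesis for \<open>Suc n\<close>, which is \<open>ge2.IH(2)\<close>,
  treats the remaining factors.\<close>

lemma \<theta>_natural:
  assumes "f \<in> Arr K"
  shows "ar \<Phi> (powA K f n) \<cdot>\<^bsub>D\<^esub> \<theta> (Cod K f) n = \<theta> (Dom K f) n \<cdot>\<^bsub>D\<^esub> powA D (ar \<Phi> f) n"
proof (induction n rule: induct_nat_012)
  case (ge2 n)
  let ?P = "powA K f (Suc n)" and ?Y = "Cod K f" and ?X = "Dom K f"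
  have "ar \<Phi> (f \<boxtimes>\<^bsub>K\<^esub> ?P) \<cdot>\<^bsub>D\<^esub> m ?Y (powO K ?Y (Suc n)) \<cdot>\<^bsub>D\<^esub> (Ide D (ob \<Phi> ?Y) \<boxtimes>\<^bsub>D\<^esub> \<theta> ?Y (Suc n))
    = (ar \<Phi> (f \<boxtimes>\<^bsub>K\<^esub> ?P) \<cdot>\<^bsub>D\<^esub> m ?Y (powO K ?Y (Suc n))) \<cdot>\<^bsub>D\<^esub> (Ide D (ob \<Phi> ?Y) \<boxtimes>\<^bsub>D\<^esub> \<theta> ?Y (Suc n))"
    using assms by simp
  also have "\<dots> = m ?X (powO K ?X (Suc n)) \<cdot>\<^bsub>D\<^esub> (ar \<Phi> f \<boxtimes>\<^bsub>D\<^esub> (ar \<Phi> ?P \<cdot>\<^bsub>D\<^esub> \<theta> ?Y (Suc n)))"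
    using ar_TensorA[of f ?P] assms by simp
  also have "\<dots> = m ?X (powO K ?X (Suc n)) \<cdot>\<^bsub>D\<^esub> (Ide D (ob \<Phi> ?X) \<boxtimes>\<^bsub>D\<^esub> \<theta> ?X (Suc n))
      \<cdot>\<^bsub>D\<^esub> (ar \<Phi> f \<boxtimes>\<^bsub>D\<^esub> powA D (ar \<Phi> f) (Suc n))"
    using ge2.IH(2) assms by simp
  finally show ?case
    using assms by simp
qed (use assms in auto)

text \<open>Conjugation with the comparisons \<open>\<theta>\<close>. The arities swap because
  \<open>\<Phi>\<close> reverses arrows.\<close>

definition transpose :: "nat \<Rightarrow> nat \<Rightarrow> 'o \<Rightarrow> 'a \<Rightarrow> 'b" where
  "transpose k n X x = inv_arr D (\<theta> X n) \<cdot>\<^bsub>D\<^esub> ar \<Phi> x \<cdot>\<^bsub>D\<^esub> \<theta> X k"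

lemma transpose_simps [simp]:
  assumes "X \<in> Obj K" "x \<in> Arr K" "Dom K x = powO K X n" "Cod K x = powO K X k"
  shows "transpose k n X x \<in> Arr D" "Dom D (transpose k n X x) = powO D (ob \<Phi> X) k"
    "Cod D (transpose k n X x) = powO D (ob \<Phi> X) n"
  using assms by (auto simp: transpose_def)

text \<open>Fullness is applied to \<open>y\<close> conjugated back by the comparisons.\<close>

lemma transpose_surj:
  assumes "X \<in> Obj K" "y \<in> Hom D (powO D (ob \<Phi> X) k) (powO D (ob \<Phi> X) n)"
  shows "\<exists>x \<in> Hom K (powO K X n) (powO K X k). transpose k n X x = y"
proof -
  have "\<theta> X n \<cdot>\<^bsub>D\<^esub> y \<cdot>\<^bsub>D\<^esub> inv_arr D (\<theta> X k) \<in> Hom D (ob \<Phi> (powO K X k)) (ob \<Phi> (powO K X n))"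
    using assms by (auto simp: in_Hom)
  then obtain x where x: "x \<in> Hom K (powO K X n) (powO K X k)"
    "ar \<Phi> x = \<theta> X n \<cdot>\<^bsub>D\<^esub> y \<cdot>\<^bsub>D\<^esub> inv_arr D (\<theta> X k)"
    using full assms(1) by (metis K.powO_in)
  then have "transpose k n X x = y"
    using assms by (auto simp: transpose_def in_Hom)
  then show ?thesis using x by blast
qed

text \<open>After composing with \<open>\<theta> X n\<close> on the left, naturality of
  \<open>\<theta>\<close> turns the square in \<open>D\<close> into the image of the square in
  \<open>K\<close>, followed on the right by \<open>\<theta> Y k\<close>. Both comparisons are
  isomorphisms and cancel, and faithfulness removes \<open>\<Phi>\<close>.\<close>

lemma operator_morphism_transpose:
  assumes h: "h \<in> Hom K X Y" and x: "x \<in> Hom K (powO K X n) (powO K X k)"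
    and y: "y \<in> Hom K (powO K Y n) (powO K Y k)"
  shows "operator_morphism k n D (transpose k n Y y) (transpose k n X x) (ar \<Phi> h)
    \<longleftrightarrow> operator_morphism n k K x y h"
proof -
  have [simp]: "h \<in> Arr K" "Dom K h = X" "Cod K h = Y" "X \<in> Obj K" "Y \<in> Obj K"
    "x \<in> Arr K" "Dom K x = powO K X n" "Cod K x = powO K X k"
    "y \<in> Arr K" "Dom K y = powO K Y n" "Cod K y = powO K Y k"
    using assms K_Dom_in K_Cod_in by (auto simp: in_Hom)
  note [simp] = \<Phi>.ar_Comp_simp
  let ?h = "\<lambda>k. ar \<Phi> (powA K h k)"
  have nat: "\<theta> X k' \<cdot>\<^bsub>D\<^esub> powA D (ar \<Phi> h) k' = ?h k' \<cdot>\<^bsub>D\<^esub> \<theta> Y k'" for k'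
    using \<theta>_natural[of h k'] by simp
  have "operator_morphism k n D (transpose k n Y y) (transpose k n X x) (ar \<Phi> h) \<longleftrightarrow>
    \<theta> X n \<cdot>\<^bsub>D\<^esub> powA D (ar \<Phi> h) n \<cdot>\<^bsub>D\<^esub> transpose k n Y y
      = \<theta> X n \<cdot>\<^bsub>D\<^esub> transpose k n X x \<cdot>\<^bsub>D\<^esub> powA D (ar \<Phi> h) k"
    unfolding operator_morphism_def
    by (rule iffI, simp only:, rule D.iso_mono[OF \<theta>_iso[of X n]]) auto
  also have "\<theta> X n \<cdot>\<^bsub>D\<^esub> powA D (ar \<Phi> h) n \<cdot>\<^bsub>D\<^esub> transpose k n Y y
    = (\<theta> X n \<cdot>\<^bsub>D\<^esub> powA D (ar \<Phi> h) n) \<cdot>\<^bsub>D\<^esub> transpose k n Y y"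
    by simp
  also have "\<dots> = (?h n \<cdot>\<^bsub>D\<^esub> ar \<Phi> y) \<cdot>\<^bsub>D\<^esub> \<theta> Y k"
    unfolding nat transpose_def by simp
  also have "\<theta> X n \<cdot>\<^bsub>D\<^esub> transpose k n X x \<cdot>\<^bsub>D\<^esub> powA D (ar \<Phi> h) k
    = ar \<Phi> x \<cdot>\<^bsub>D\<^esub> \<theta> X k \<cdot>\<^bsub>D\<^esub> powA D (ar \<Phi> h) k"
    unfolding transpose_def by simp
  also have "\<dots> = (ar \<Phi> x \<cdot>\<^bsub>D\<^esub> ?h k) \<cdot>\<^bsub>D\<^esub> \<theta> Y k"
    unfolding nat by simp
  also have "(?h n \<cdot>\<^bsub>D\<^esub> ar \<Phi> y) \<cdot>\<^bsub>D\<^esub> \<theta> Y k = (ar \<Phi> x \<cdot>\<^bsub>D\<^esub> ?h k) \<cdot>\<^bsub>D\<^esub> \<theta> Y k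
    \<longleftrightarrow> ?h n \<cdot>\<^bsub>D\<^esub> ar \<Phi> y = ar \<Phi> x \<cdot>\<^bsub>D\<^esub> ?h k"
    by (rule iffI, rule D.iso_epi[OF \<theta>_iso[of Y k]]) auto
  also have "\<dots> \<longleftrightarrow> ar \<Phi> (powA K h k \<cdot>\<^bsub>K\<^esub> x) = ar \<Phi> (y \<cdot>\<^bsub>K\<^esub> powA K h n)"
    by (auto simp del: D.Comp_assoc_simp)
  also have "\<dots> \<longleftrightarrow> operator_morphism n k K x y h"
    unfolding operator_morphism_def by (rule iffI, rule faithful_Arr) auto
  finally show ?thesis .
qed

text \<open>A \<open>U\<close>-operator contains an object of \<open>C\<close>, which its image
  under \<open>U\<close> need not determine. The map \<open>Q\<close> therefore records a
  factorization of \<open>\<Phi>\<close> through \<open>U\<close> on objects, and essential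
  surjectivity is required of \<open>Q\<close> in \<open>C\<close>.\<close>

theorem dually_equivalent_Op:
  fixes C :: "('oc, 'ac, 'mc) cat_scheme" and U :: "('oc, 'ac, 'p, 'b) fun_data"
    and A :: "('o, 'a1, 'm1) cat_scheme" and J :: "('o, 'a1, 'o, 'a) fun_data"
    and Q :: "'o \<Rightarrow> 'oc"
  assumes U: "is_functor C D U"
    and A: "Obj A = Obj K" and J: "\<And>X. ob J X = X"
    and Q: "\<And>X. X \<in> Obj K \<Longrightarrow> Q X \<in> Obj C" and \<Phi>: "\<And>X. X \<in> Obj K \<Longrightarrow> ob \<Phi> X = ob U (Q X)"
    and ess_surj: "\<And>Z. Z \<in> Obj C \<Longrightarrow> \<exists>X \<in> Obj K. \<exists>i \<in> Hom C Z (Q X). iso C i"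
  shows "dually_equivalent (Op k n C D U) (Op n k A K J)"
proof -
  interpret U: is_functor C D U by (rule U)
  define \<Psi> where "\<Psi> =
    \<lparr>ob = (\<lambda>(X, x). (Q X, transpose k n X x)),
     ar = (\<lambda>((X, x), h, (Y, y)). ((Q Y, transpose k n Y y), ar \<Phi> h, (Q X, transpose k n X x)))\<rparr>"
  have \<Psi>_ob [simp]: "ob \<Psi> p = (Q (fst p), transpose k n (fst p) (snd p))" for p
    by (cases p) (simp add: \<Psi>_def)
  have \<Psi>_ar [simp]: "ar \<Psi> (p, h, q) = (ob \<Psi> q, ar \<Phi> h, ob \<Psi> p)" for p h q
    by (cases p; cases q) (simp add: \<Psi>_def)
  note [simp] = A J Q \<Phi>[symmetric]
  have cat: "category (Op n k A K J)" "category (Op k n C D U)"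
    using U.ob_in by (auto intro!: K.category_Op D.category_Op)
  show ?thesis
  proof (rule dually_equivalentI)
    show "contravariant_functor (Op n k A K J) (Op k n C D U) \<Psi>"
    proof (intro contravariant_functor.intro cat contravariant_functor_axioms.intro)
      fix f p q assume "f \<in> Hom (Op n k A K J) p q"
      then show "ar \<Psi> f \<in> Hom (Op k n C D U) (ob \<Psi> q) (ob \<Psi> p)"
        by (cases f) (auto simp: in_Hom operator_morphism_transpose)
    next
      fix f g p q r assume "f \<in> Hom (Op n k A K J) p q" "g \<in> Hom (Op n k A K J) q r"
      then show "ar \<Psi> (g \<cdot>\<^bsub>Op n k A K J\<^esub> f) = ar \<Psi> f \<cdot>\<^bsub>Op k n C D U\<^esub> ar \<Psi> g"
        by (cases f; cases g) (auto simp: in_Hom \<Phi>.ar_Comp_simp)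
    qed auto
  next
    fix p q f g
    assume "f \<in> Hom (Op n k A K J) p q" "g \<in> Hom (Op n k A K J) p q" "ar \<Psi> f = ar \<Psi> g"
    then show "f = g"
      by (cases f; cases g) (auto simp: in_Hom intro: faithful_Arr)
  next
    fix p q h
    assume p: "p \<in> Obj (Op n k A K J)" and q: "q \<in> Obj (Op n k A K J)"
      and h: "h \<in> Hom (Op k n C D U) (ob \<Psi> q) (ob \<Psi> p)"
    obtain v where v: "h = (ob \<Psi> q, v, ob \<Psi> p)"
      using h by (cases h) (auto simp: in_Hom)
    have "v \<in> Hom D (ob \<Phi> (fst q)) (ob \<Phi> (fst p))"
      using h p q unfolding v by (auto simp: in_Hom)
    then obtain f where f: "f \<in> Hom K (fst p) (fst q)" "ar \<Phi> f = v"
      using full[of "fst p" "fst q" v] p q by auto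
    \<comment> \<open>The arrow \<open>f\<close> lifted by fullness respects the operators because
      \<open>operator_morphism_transpose\<close> is an equivalence.\<close>
    have "(p, f, q) \<in> Hom (Op n k A K J) p q"
      using h p q f operator_morphism_transpose[OF f(1), of "snd p" n k "snd q"]
      unfolding v by (auto simp: in_Hom)
    then show "\<exists>f \<in> Hom (Op n k A K J) p q. ar \<Psi> f = h"
      using f(2) v by (intro bexI[of _ "(p, f, q)"]) auto
  next
    fix p assume "p \<in> Obj (Op k n C D U)"
    then obtain Z a where p: "p = (Z, a)" and Z: "Z \<in> Obj C"
      and a: "a \<in> Arr D" "Dom D a = powO D (ob U Z) k" "Cod D a = powO D (ob U Z) n"
      by (cases p) auto
    obtain X i where X: "X \<in> Obj K" and i: "i \<in> Hom C Z (Q X)" "iso C i"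
      using ess_surj[OF Z] by blast
    \<comment> \<open>The operator \<open>a\<close> is transported along \<open>j\<close> to the
      image of \<open>X\<close> and then written as a transpose. By construction \<open>j\<close> is
      a morphism of operators, and it is invertible.\<close>
    define j where "j = ar U i"
    obtain j' where inv: "inverse_arrows D j j'"
      using U.iso_ar[OF i(2)] by (auto simp: j_def iso_def)
    have j: "j \<in> Arr D" "Dom D j = ob U Z" "Cod D j = ob \<Phi> X"
      using i(1) X by (auto simp: j_def in_Hom)
    have j': "j' \<in> Arr D" "Dom D j' = ob \<Phi> X" "Cod D j' = ob U Z"
      using inv j by (auto simp: inverse_arrows_def in_Hom)
    have powA_inv: "powA D j' k \<cdot>\<^bsub>D\<^esub> powA D j k = Ide D (powO D (ob U Z) k)"
      using D.inverse_arrows_powA[OF inv, of k] j by (auto simp: inverse_arrows_def in_Hom)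
    have "powA D j n \<cdot>\<^bsub>D\<^esub> a \<cdot>\<^bsub>D\<^esub> powA D j' k \<in> Hom D (powO D (ob \<Phi> X) k) (powO D (ob \<Phi> X) n)"
      using a j j' by (auto simp: in_Hom)
    then obtain x where x: "x \<in> Hom K (powO K X n) (powO K X k)"
      "transpose k n X x = powA D j n \<cdot>\<^bsub>D\<^esub> a \<cdot>\<^bsub>D\<^esub> powA D j' k"
      using transpose_surj[OF X] by blast
    have "operator_morphism k n D a (transpose k n X x) j"
      using a j j' powA_inv by (simp add: operator_morphism_def x(2))
    then have arr: "(p, j, ob \<Psi> (X, x)) \<in> Arr (Op k n C D U)"
      using X x(1) Z a j by (simp add: p in_Hom)
    have "iso (Op k n C D U) (p, j, ob \<Psi> (X, x))"
      using D.inverse_arrows_Op[OF arr inv] unfolding iso_def by blast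
    then show "\<exists>q \<in> Obj (Op n k A K J). \<exists>f \<in> Hom (Op k n C D U) p (ob \<Psi> q). iso (Op k n C D U) f"
      using arr X x(1) by (intro bexI[of _ "(X, x)"] bexI[of _ "(p, j, ob \<Psi> (X, x))"]) (auto simp: in_Hom)
  qed
qed

end

section \<open>The Kleisli category of the dual monad\<close>

lemma dual_moncat_simps [simp]:
  "Obj (dual_moncat C C' d) = Obj C'" "Arr (dual_moncat C C' d) = Arr C'"
  "Dom (dual_moncat C C' d) = Dom C'" "Cod (dual_moncat C C' d) = Cod C'"
  "Ide (dual_moncat C C' d) = Ide C'" "Comp (dual_moncat C C' d) = Comp C'"
  "TensorO (dual_moncat C C' d) X Y = ob (hat d) (ob (cohat d) X \<otimes>\<^bsub>C\<^esub> ob (cohat d) Y)"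
  "TensorA (dual_moncat C C' d) f g = ar (hat d) (ar (cohat d) f \<boxtimes>\<^bsub>C\<^esub> ar (cohat d) g)"
  "UnitO (dual_moncat C C' d) = ob (hat d) \<I>\<^bsub>C\<^esub>"
  by (simp_all add: dual_moncat_def)

lemma Hom_dual_moncat [simp]: "Hom (dual_moncat C C' d) = Hom C'"
  by (simp add: Hom_def fun_eq_iff)

lemma inv_arr_dual_moncat [simp]: "inv_arr (dual_moncat C C' d) = inv_arr C'"
  by (simp add: inv_arr_def inverse_arrows_def fun_eq_iff)

lemma dual_functor_simps [simp]:
  "ob (dual_functor dA dB G) X = ob (hat dB) (ob G (ob (cohat dA) X))"
  "ar (dual_functor dA dB G) f = ar (hat dB) (ar G (ar (cohat dA) f))"
  by (simp_all add: dual_functor_def fun_comp_def)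

lemma kleisli_simps [simp]:
  "Obj (kleisli C T) = Obj C"
  "(X, f, Y) \<in> Arr (kleisli C T) \<longleftrightarrow> X \<in> Obj C \<and> Y \<in> Obj C \<and> f \<in> Hom C X (ob (Mfun T) Y)"
  "Dom (kleisli C T) (X, f, Y) = X"
  "Cod (kleisli C T) (X, f, Y) = Y"
  "Ide (kleisli C T) X = (X, Munit T X, X)"
  "(Y, g, Z) \<cdot>\<^bsub>kleisli C T\<^esub> (X, f, Y') = (X, Mmult T Z \<cdot>\<^bsub>C\<^esub> ar (Mfun T) g \<cdot>\<^bsub>C\<^esub> f, Z)"
  "X \<otimes>\<^bsub>kleisli C T\<^esub> X' = X \<otimes>\<^bsub>C\<^esub> X'"
  "(X, f, Y) \<boxtimes>\<^bsub>kleisli C T\<^esub> (X', g, Y'')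
    = (X \<otimes>\<^bsub>C\<^esub> X', Mlax T Y Y'' \<cdot>\<^bsub>C\<^esub> (f \<boxtimes>\<^bsub>C\<^esub> g), Y \<otimes>\<^bsub>C\<^esub> Y'')"
  "\<I>\<^bsub>kleisli C T\<^esub> = \<I>\<^bsub>C\<^esub>"
  by (simp_all add: kleisli_def)

lemma Hom_kleisli:
  "t \<in> Hom (kleisli C T) X Y \<longleftrightarrow>
    X \<in> Obj C \<and> Y \<in> Obj C \<and> (\<exists>f \<in> Hom C X (ob (Mfun T) Y). t = (X, f, Y))"
  by (cases t) (auto simp: in_Hom)

section \<open>Double duals in a dual adjoint equivalence\<close>

context dual_adjoint_equivalence
begin

sublocale P: contravariant_functor C C' "hat d"
  by (rule contravariant_functor_op_cat) (rule hat.is_functor_axioms)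

sublocale Q: contravariant_functor C' C "cohat d"
  by (rule contravariant_functor_op_cat) (rule cohat.is_functor_axioms)

declare P.ob_in [simp] Q.ob_in [simp] P.ar_Ide [simp] Q.ar_Ide [simp]

lemma hat_iso_simps [simp]:
  assumes "X \<in> Obj C'"
  shows "hat_iso d X \<in> Arr C'" "Dom C' (hat_iso d X) = X"
    "Cod C' (hat_iso d X) = ob (hat d) (ob (cohat d) X)" "iso C' (hat_iso d X)"
  using hat_iso.component_in[OF assms] hat_iso.component_iso[OF assms]
  by (auto simp: in_Hom fun_id_def fun_comp_def)

lemma cohat_iso_simps [simp]:
  assumes "Y \<in> Obj C"
  shows "cohat_iso d Y \<in> Arr C" "Dom C (cohat_iso d Y) = Y"
    "Cod C (cohat_iso d Y) = ob (cohat d) (ob (hat d) Y)" "iso C (cohat_iso d Y)"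
  using cohat_iso.component_in[OF assms] cohat_iso.component_iso[OF assms]
  by (auto simp: in_Hom fun_id_def fun_comp_def)

lemma hat_iso_natural:
  "f \<in> Arr C' \<Longrightarrow> ar (hat d) (ar (cohat d) f) \<cdot>\<^bsub>C'\<^esub> hat_iso d (Dom C' f) = hat_iso d (Cod C' f) \<cdot>\<^bsub>C'\<^esub> f"
  using hat_iso.naturality[of f "Dom C' f" "Cod C' f"] by (simp add: in_Hom fun_id_def fun_comp_def)

lemma cohat_iso_natural:
  "f \<in> Arr C \<Longrightarrow> ar (cohat d) (ar (hat d) f) \<cdot>\<^bsub>C\<^esub> cohat_iso d (Dom C f) = cohat_iso d (Cod C f) \<cdot>\<^bsub>C\<^esub> f"
  using cohat_iso.naturality[of f "Dom C f" "Cod C f"] by (simp add: in_Hom fun_id_def fun_comp_def)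

text \<open>The triangle identity exhibits a left inverse, and a left inverse of an isomorphism is
  its inverse. This evaluates the inverse occurring in \<open>dual_unit\<close> at dual
  objects.\<close>

lemma inv_hat_iso:
  assumes "Y \<in> Obj C"
  shows "inv_arr C' (hat_iso d (ob (hat d) Y)) = ar (hat d) (cohat_iso d Y)"
proof -
  let ?a = "hat_iso d (ob (hat d) Y)"
  have "inv_arr C' ?a = (ar (hat d) (cohat_iso d Y) \<cdot>\<^bsub>C'\<^esub> ?a) \<cdot>\<^bsub>C'\<^esub> inv_arr C' ?a"
    unfolding triangle_hat[OF assms] using assms by simp
  also have "\<dots> = ar (hat d) (cohat_iso d Y)"
    using assms by simp
  finally show ?thesis .
qed

text \<open>Naturality of \<open>hat_iso\<close> recovers an arrow from its double dual, up to an
  isomorphism that cancels.\<close>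

lemma Q_faithful:
  assumes "f \<in> Arr C'" "g \<in> Arr C'" "Dom C' f = Dom C' g" "Cod C' f = Cod C' g"
    and "ar (cohat d) f = ar (cohat d) g"
  shows "f = g"
proof (rule hat.B.iso_mono)
  show "hat_iso d (Cod C' f) \<cdot>\<^bsub>C'\<^esub> f = hat_iso d (Cod C' f) \<cdot>\<^bsub>C'\<^esub> g"
    using hat_iso_natural[OF assms(1)] hat_iso_natural[OF assms(2)] unfolding assms(3-5) by metis
qed (use assms in auto)

end

section \<open>The dual adjunction and its monad\<close>

locale dual_monoidal_adjunction =
  C: dual_adjoint_equivalence C C' dC + D: dual_adjoint_equivalence D D' dD
  + adjunction D C F U \<eta> \<epsilon> + U: strong_monoidal_functor C D U l e
  for C :: "('oc, 'ac) moncat" and D :: "('od, 'ad) moncat"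
    and C' :: "('oc1, 'ac1) cat" and D' :: "('od1, 'ad1) cat"
    and dC :: "('oc, 'ac, 'oc1, 'ac1) dual_data" and dD :: "('od, 'ad, 'od1, 'ad1) dual_data"
    and F :: "('od, 'ad, 'oc, 'ac) fun_data" and U :: "('oc, 'ac, 'od, 'ad) fun_data"
    and \<eta> :: "'od \<Rightarrow> 'ad" and \<epsilon> :: "'oc \<Rightarrow> 'ac"
    and l :: "'oc \<Rightarrow> 'oc \<Rightarrow> 'ad" and e :: 'ad
begin

abbreviation "P \<equiv> hat dC"
abbreviation "Q \<equiv> cohat dC"
abbreviation "p \<equiv> hat dD"
abbreviation "q \<equiv> cohat dD"
abbreviation "\<alpha> \<equiv> hat_iso dC"
abbreviation "\<beta> \<equiv> cohat_iso dC"
abbreviation "a \<equiv> hat_iso dD"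
abbreviation "b \<equiv> cohat_iso dD"
abbreviation "Ch \<equiv> dual_moncat C C' dC"
abbreviation "Dh \<equiv> dual_moncat D D' dD"
abbreviation "Uh \<equiv> dual_functor dC dD U"
abbreviation "Fh \<equiv> dual_functor dD dC F"
text \<open>Dualizing exchanges unit and counit: \<open>unit_T\<close> stems from
  \<open>\<epsilon>\<close> and is the unit of \<open>T\<close>, while \<open>counit_D\<close> stems
  from \<open>\<eta>\<close> and enters its multiplication.\<close>

abbreviation "unit_T \<equiv> dual_counit C D C' dC dD F U \<epsilon>"
abbreviation "counit_D \<equiv> dual_unit D' dC dD F U \<eta>"
abbreviation "lax_U \<equiv> dual_laxator C D D' dC dD U l"
abbreviation "T \<equiv> adjunction_monad Ch Dh Uh Fh unit_T counit_D lax_U"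

sublocale C: tensor_category C by (rule U.C.tensor_category)
sublocale D: tensor_category D by (rule U.D.tensor_category)

declare L.ob_in [simp] R.ob_in [simp] L.ar_Ide [simp] R.ar_Ide [simp]

lemma adj_unit_simps [simp]:
  assumes "Y \<in> Obj D"
  shows "\<eta> Y \<in> Arr D" "Dom D (\<eta> Y) = Y" "Cod D (\<eta> Y) = ob U (ob F Y)"
  using \<eta>.component_in[OF assms] by (auto simp: in_Hom fun_id_def fun_comp_def)

lemma adj_counit_simps [simp]:
  assumes "X \<in> Obj C"
  shows "\<epsilon> X \<in> Arr C" "Dom C (\<epsilon> X) = ob F (ob U X)" "Cod C (\<epsilon> X) = X"
  using \<epsilon>.component_in[OF assms] by (auto simp: in_Hom fun_id_def fun_comp_def)

lemma adj_unit_natural: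
  "f \<in> Arr D \<Longrightarrow> ar U (ar F f) \<cdot>\<^bsub>D\<^esub> \<eta> (Dom D f) = \<eta> (Cod D f) \<cdot>\<^bsub>D\<^esub> f"
  using \<eta>.naturality[of f "Dom D f" "Cod D f"] by (simp add: in_Hom fun_id_def fun_comp_def)

lemma adj_counit_natural:
  "f \<in> Arr C \<Longrightarrow> \<epsilon> (Cod C f) \<cdot>\<^bsub>C\<^esub> ar F (ar U f) = f \<cdot>\<^bsub>C\<^esub> \<epsilon> (Dom C f)"
  using \<epsilon>.naturality[of f "Dom C f" "Cod C f"] by (simp add: in_Hom fun_id_def fun_comp_def)

lemma laxator_simps [simp]:
  assumes "X \<in> Obj C" "Y \<in> Obj C"
  shows "l X Y \<in> Arr D" "Dom D (l X Y) = ob U X \<otimes>\<^bsub>D\<^esub> ob U Y"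
    "Cod D (l X Y) = ob U (X \<otimes>\<^bsub>C\<^esub> Y)" "iso D (l X Y)"
  using U.l_in[OF assms] U.l_iso[OF assms] by (auto simp: in_Hom)

text \<open>Naturality of the counit followed by \<open>triangle_L\<close>. This half of the hom-set
  bijection makes transposition injective.\<close>

lemma transpose_eq:
  assumes "h \<in> Arr C" "Dom C h = ob F V" "V \<in> Obj D"
  shows "\<epsilon> (Cod C h) \<cdot>\<^bsub>C\<^esub> ar F (ar U h \<cdot>\<^bsub>D\<^esub> \<eta> V) = h"
proof -
  have "\<epsilon> (Cod C h) \<cdot>\<^bsub>C\<^esub> ar F (ar U h \<cdot>\<^bsub>D\<^esub> \<eta> V) = (\<epsilon> (Cod C h) \<cdot>\<^bsub>C\<^esub> ar F (ar U h)) \<cdot>\<^bsub>C\<^esub> ar F (\<eta> V)"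
    using assms by (simp add: L.ar_Comp_simp)
  also have "\<dots> = h \<cdot>\<^bsub>C\<^esub> \<epsilon> (ob F V) \<cdot>\<^bsub>C\<^esub> ar F (\<eta> V)"
    using assms adj_counit_natural[of h] by simp
  also have "\<dots> = h"
    using assms triangle_L[of V] by simp
  finally show ?thesis .
qed

text \<open>The adjunction unit \<open>A -> U F A\<close> with the double dual isomorphisms of
  \<open>D\<close> and \<open>C\<close> inserted.\<close>

definition \<gamma> :: "'od \<Rightarrow> 'ad" where
  "\<gamma> A = ar U (\<beta> (ob F (ob q (ob p A)))) \<cdot>\<^bsub>D\<^esub> \<eta> (ob q (ob p A)) \<cdot>\<^bsub>D\<^esub> b A"

text \<open>The strong monoidal structure of the composite of \<open>U\<close> and \<open>Q\<close>.
  The tensor on \<open>C'\<close> is the dual of a tensor in \<open>C\<close>, so \<open>l\<close>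
  must be followed by a double dual isomorphism.\<close>

definition m :: "'oc1 \<Rightarrow> 'oc1 \<Rightarrow> 'ad" where
  "m X Y = ar U (\<beta> (ob Q X \<otimes>\<^bsub>C\<^esub> ob Q Y)) \<cdot>\<^bsub>D\<^esub> l (ob Q X) (ob Q Y)"

text \<open>Up to \<open>p\<close>, this is the comparison functor from the Kleisli category to \<open>D'\<close>.\<close>

definition \<Phi> :: "('oc1, 'oc1 \<times> 'ac1 \<times> 'oc1, 'od, 'ad) fun_data" where
  "\<Phi> = \<lparr>ob = (\<lambda>X. ob U (ob Q X)), ar = (\<lambda>(X, f, Y). ar U (ar Q f) \<cdot>\<^bsub>D\<^esub> \<gamma> (ob U (ob Q Y)))\<rparr>"

lemma \<Phi>_simps [simp]:
  "ob \<Phi> X = ob U (ob Q X)" "ar \<Phi> (X, f, Y) = ar U (ar Q f) \<cdot>\<^bsub>D\<^esub> \<gamma> (ob U (ob Q Y))"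
  by (simp_all add: \<Phi>_def)

abbreviation FqpUQ :: "'oc1 \<Rightarrow> 'oc" where "FqpUQ X \<equiv> ob F (ob q (ob p (ob U (ob Q X))))"

lemma T_simps [simp]:
  "ob (Mfun T) X = ob P (FqpUQ X)"
  "ar (Mfun T) f = ar P (ar F (ar q (ar p (ar U (ar Q f)))))"
  "Munit T = unit_T"
  "Mmult T X = ar P (ar F (ar q (counit_D (ob p (ob U (ob Q X))))))"
  "Mlax T X Y = ar Fh (lax_U X Y) \<cdot>\<^bsub>C'\<^esub>
    right_adjoint_lax Ch Dh Fh unit_T counit_D lax_U (ob Uh X) (ob Uh Y)"
  by (simp_all add: adjunction_monad_def fun_comp_def)

section \<open>Evaluation of the comparison functor\<close>

lemma \<gamma>_simps [simp]:
  assumes "A \<in> Obj D"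
  shows "\<gamma> A \<in> Arr D" "Dom D (\<gamma> A) = A" "Cod D (\<gamma> A) = ob U (ob Q (ob P (ob F (ob q (ob p A)))))"
  using assms by (simp_all add: \<gamma>_def)

text \<open>The naturality squares of \<open>b\<close>, \<open>\<eta>\<close> and
  \<open>\<beta>\<close> are pasted together.\<close>

lemma \<gamma>_natural:
  assumes "v \<in> Arr D"
  shows "ar U (ar Q (ar P (ar F (ar q (ar p v))))) \<cdot>\<^bsub>D\<^esub> \<gamma> (Dom D v) = \<gamma> (Cod D v) \<cdot>\<^bsub>D\<^esub> v"
proof -
  let ?v = "ar q (ar p v)" and ?V = "ob q (ob p (Dom D v))" and ?W = "ob q (ob p (Cod D v))"
  have "ar U (ar Q (ar P (ar F ?v))) \<cdot>\<^bsub>D\<^esub> \<gamma> (Dom D v)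
    = ar U (ar Q (ar P (ar F ?v)) \<cdot>\<^bsub>C\<^esub> \<beta> (ob F ?V)) \<cdot>\<^bsub>D\<^esub> \<eta> ?V \<cdot>\<^bsub>D\<^esub> b (Dom D v)"
    using assms by (simp add: \<gamma>_def R.ar_Comp_simp)
  also have "\<dots> = ar U (\<beta> (ob F ?W)) \<cdot>\<^bsub>D\<^esub> (ar U (ar F ?v) \<cdot>\<^bsub>D\<^esub> \<eta> ?V) \<cdot>\<^bsub>D\<^esub> b (Dom D v)"
    using assms C.cohat_iso_natural[of "ar F ?v"] by (simp add: R.ar_Comp_simp)
  also have "\<dots> = ar U (\<beta> (ob F ?W)) \<cdot>\<^bsub>D\<^esub> \<eta> ?W \<cdot>\<^bsub>D\<^esub> ?v \<cdot>\<^bsub>D\<^esub> b (Dom D v)"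
    using assms adj_unit_natural[of ?v] by simp
  also have "\<dots> = \<gamma> (Cod D v) \<cdot>\<^bsub>D\<^esub> v"
    using assms D.cohat_iso_natural[of v] by (simp add: \<gamma>_def)
  finally show ?thesis .
qed

text \<open>By \<open>inv_hat_iso\<close> all three factors of \<open>dual_unit\<close> are duals of
  the factors of \<open>\<gamma>\<close>. The multiplication and the monoidal structure of
  \<open>T\<close> use the counit at objects of this form.\<close>

lemma counit_D_eq:
  assumes "A \<in> Obj D"
  shows "counit_D (ob p A) = ar p (\<gamma> A)"
  using assms by (simp add: dual_unit_def D.inv_hat_iso \<gamma>_def D.P.ar_Comp_simp)

text \<open>This puts the unit into the shape that \<open>\<Phi>_transpose\<close> evaluates, with
  the inverse of \<open>b\<close> as \<open>w\<close>.\<close>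

lemma unit_T_eq:
  assumes "X \<in> Obj C'"
  shows "unit_T X = ar P (\<epsilon> (ob Q X) \<cdot>\<^bsub>C\<^esub> ar F (inv_arr D (b (ob U (ob Q X))))) \<cdot>\<^bsub>C'\<^esub> \<alpha> X"
  using assms by (simp add: dual_counit_def C.P.ar_Comp_simp)

text \<open>The Kleisli morphism is the dual of the adjoint transpose of \<open>w\<close>. The
  triangle identity of the dual equivalence removes \<open>\<alpha>\<close> and
  \<open>\<beta>\<close>; naturality of \<open>\<eta>\<close> and \<open>triangle_R\<close> undo the
  transposition. Identities, fullness and the monoidal structure all rest on this
  computation.\<close>

lemma \<Phi>_transpose:
  assumes X: "X \<in> Obj C'" and Y: "Y \<in> Obj C'"
    and w: "w \<in> Arr D" "Dom D w = ob q (ob p (ob U (ob Q Y)))" "Cod D w = ob U (ob Q X)"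
  shows "ar \<Phi> (X, ar P (\<epsilon> (ob Q X) \<cdot>\<^bsub>C\<^esub> ar F w) \<cdot>\<^bsub>C'\<^esub> \<alpha> X, Y) = w \<cdot>\<^bsub>D\<^esub> b (ob U (ob Q Y))"
proof -
  let ?g = "\<epsilon> (ob Q X) \<cdot>\<^bsub>C\<^esub> ar F w" and ?V = "ob q (ob p (ob U (ob Q Y)))"
  have g: "?g \<in> Arr C" "Dom C ?g = ob F ?V" "Cod C ?g = ob Q X"
    using assms by auto
  have "(ar Q (\<alpha> X) \<cdot>\<^bsub>C\<^esub> ar Q (ar P ?g)) \<cdot>\<^bsub>C\<^esub> \<beta> (ob F ?V) = ar Q (\<alpha> X) \<cdot>\<^bsub>C\<^esub> \<beta> (ob Q X) \<cdot>\<^bsub>C\<^esub> ?g"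
    using C.cohat_iso_natural[OF g(1)] g X Y
    by (simp del: L.ar_simps)
  also have "\<dots> = (ar Q (\<alpha> X) \<cdot>\<^bsub>C\<^esub> \<beta> (ob Q X)) \<cdot>\<^bsub>C\<^esub> ?g"
    using assms by simp
  also have "\<dots> = ?g"
    unfolding C.triangle_cohat[OF X] using assms by simp
  finally have 1: "(ar Q (\<alpha> X) \<cdot>\<^bsub>C\<^esub> ar Q (ar P ?g)) \<cdot>\<^bsub>C\<^esub> \<beta> (ob F ?V) = ?g" .
  have "ar \<Phi> (X, ar P ?g \<cdot>\<^bsub>C'\<^esub> \<alpha> X, Y)
    = ar U ((ar Q (\<alpha> X) \<cdot>\<^bsub>C\<^esub> ar Q (ar P ?g)) \<cdot>\<^bsub>C\<^esub> \<beta> (ob F ?V)) \<cdot>\<^bsub>D\<^esub> \<eta> ?V \<cdot>\<^bsub>D\<^esub> b (ob U (ob Q Y))"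
    using assms by (simp add: \<gamma>_def R.ar_Comp_simp C.Q.ar_Comp_simp C.P.ar_Comp_simp)
  also have "\<dots> = ar U (\<epsilon> (ob Q X)) \<cdot>\<^bsub>D\<^esub> (ar U (ar F w) \<cdot>\<^bsub>D\<^esub> \<eta> ?V) \<cdot>\<^bsub>D\<^esub> b (ob U (ob Q Y))"
    unfolding 1 using assms by (simp add: R.ar_Comp_simp)
  also have "\<dots> = (ar U (\<epsilon> (ob Q X)) \<cdot>\<^bsub>D\<^esub> \<eta> (ob U (ob Q X))) \<cdot>\<^bsub>D\<^esub> w \<cdot>\<^bsub>D\<^esub> b (ob U (ob Q Y))"
    using assms adj_unit_natural[of w] by simp
  also have "\<dots> = w \<cdot>\<^bsub>D\<^esub> b (ob U (ob Q Y))"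
    using assms triangle_R[of "ob Q X"] by simp
  finally show ?thesis .
qed

text \<open>Here \<open>g\<close> is precomposed in \<open>C'\<close>, not in the Kleisli category,
  and so contributes its plain image under \<open>Q\<close> and \<open>U\<close>.\<close>

lemma \<Phi>_precompose:
  assumes "g \<in> Hom C' X V" "h \<in> Hom C' V (ob P (FqpUQ Y))" "Y \<in> Obj C'"
  shows "ar \<Phi> (X, h \<cdot>\<^bsub>C'\<^esub> g, Y) = ar U (ar Q g) \<cdot>\<^bsub>D\<^esub> ar \<Phi> (V, h, Y)"
  using assms by (auto simp: in_Hom C.Q.ar_Comp_simp R.ar_Comp_simp)

section \<open>Monoidal structure of the comparison functor\<close>

lemma m_simps [simp]:
  assumes "X \<in> Obj C'" "Y \<in> Obj C'"
  shows "m X Y \<in> Arr D" "Dom D (m X Y) = ob U (ob Q X) \<otimes>\<^bsub>D\<^esub> ob U (ob Q Y)"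
    "Cod D (m X Y) = ob U (ob Q (ob P (ob Q X \<otimes>\<^bsub>C\<^esub> ob Q Y)))" "iso D (m X Y)"
  using assms by (auto simp: m_def R.iso_ar intro!: D.cohat.B.iso_Comp)

lemma m_natural:
  assumes "f \<in> Hom C' X Y" "f' \<in> Hom C' X' Y'"
  shows "ar U (ar Q (ar P (ar Q f \<boxtimes>\<^bsub>C\<^esub> ar Q f'))) \<cdot>\<^bsub>D\<^esub> m Y Y'
    = m X X' \<cdot>\<^bsub>D\<^esub> (ar U (ar Q f) \<boxtimes>\<^bsub>D\<^esub> ar U (ar Q f'))"
proof -
  have [simp]: "f \<in> Arr C'" "Dom C' f = X" "Cod C' f = Y" "f' \<in> Arr C'" "Dom C' f' = X'" "Cod C' f' = Y'"
    "X \<in> Obj C'" "Y \<in> Obj C'" "X' \<in> Obj C'" "Y' \<in> Obj C'"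
    using assms C.hat.B.Dom_in C.hat.B.Cod_in by (auto simp: in_Hom)
  let ?t = "ar Q f \<boxtimes>\<^bsub>C\<^esub> ar Q f'"
  have "ar U (ar Q (ar P ?t)) \<cdot>\<^bsub>D\<^esub> m Y Y'
    = ar U (ar Q (ar P ?t) \<cdot>\<^bsub>C\<^esub> \<beta> (ob Q Y \<otimes>\<^bsub>C\<^esub> ob Q Y')) \<cdot>\<^bsub>D\<^esub> l (ob Q Y) (ob Q Y')"
    by (simp add: m_def R.ar_Comp_simp)
  also have "\<dots> = ar U (\<beta> (ob Q X \<otimes>\<^bsub>C\<^esub> ob Q X')) \<cdot>\<^bsub>D\<^esub> ar U ?t \<cdot>\<^bsub>D\<^esub> l (ob Q Y) (ob Q Y')"
    using C.cohat_iso_natural[of ?t] by (simp add: R.ar_Comp_simp)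
  also have "\<dots> = m X X' \<cdot>\<^bsub>D\<^esub> (ar U (ar Q f) \<boxtimes>\<^bsub>D\<^esub> ar U (ar Q f'))"
    using U.l_natural[of "ar Q f" "ob Q Y" "ob Q X" "ar Q f'" "ob Q Y'" "ob Q X'"]
    by (simp add: m_def in_Hom)
  finally show ?thesis .
qed

text \<open>Chosen so that its dual is the laxator \<open>lax_U X Y\<close>: it inverts
  \<open>m\<close> and inserts double duals on the two factors.\<close>

definition \<kappa> :: "'oc1 \<Rightarrow> 'oc1 \<Rightarrow> 'ad" where
  "\<kappa> X Y = (b (ob U (ob Q X)) \<boxtimes>\<^bsub>D\<^esub> b (ob U (ob Q Y))) \<cdot>\<^bsub>D\<^esub> inv_arr D (m X Y)"

lemma \<kappa>_simps [simp]:
  assumes "X \<in> Obj C'" "Y \<in> Obj C'"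
  shows "\<kappa> X Y \<in> Arr D" "Dom D (\<kappa> X Y) = ob U (ob Q (ob P (ob Q X \<otimes>\<^bsub>C\<^esub> ob Q Y)))"
    "Cod D (\<kappa> X Y) = ob q (ob p (ob U (ob Q X))) \<otimes>\<^bsub>D\<^esub> ob q (ob p (ob U (ob Q Y)))"
    "iso D (\<kappa> X Y)"
    "inv_arr D (\<kappa> X Y) = m X Y \<cdot>\<^bsub>D\<^esub> (inv_arr D (b (ob U (ob Q X))) \<boxtimes>\<^bsub>D\<^esub> inv_arr D (b (ob U (ob Q Y))))"
  using assms
  by (auto simp: \<kappa>_def D.cohat.B.inv_arr_Comp D.iso_TensorA D.cohat.B.iso_inv_arr D.cohat.B.inv_arr_inv_arr D.inv_arr_TensorA
      intro!: D.cohat.B.iso_Comp)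

lemma lax_U_eq:
  assumes "X \<in> Obj C'" "Y \<in> Obj C'"
  shows "lax_U X Y = ar p (\<kappa> X Y)"
proof -
  let ?A = "ob Q X" and ?B = "ob Q Y"
  have "inv_arr D (m X Y) = inv_arr D (l ?A ?B) \<cdot>\<^bsub>D\<^esub> ar U (inv_arr C (\<beta> (?A \<otimes>\<^bsub>C\<^esub> ?B)))"
    using assms by (simp add: m_def D.cohat.B.inv_arr_Comp R.iso_ar R.inv_arr_ar)
  then show ?thesis
    using assms by (simp add: dual_laxator_def Let_def \<kappa>_def D.P.ar_Comp_simp)
qed

text \<open>Apart from the unit at \<open>V\<close>, all factors of \<open>Mlax\<close> are images
  under \<open>P\<close>, \<open>F\<close>, \<open>q\<close>, \<open>p\<close> in succession. This
  passage reverses arrows, so they merge into the image of the single arrow \<open>\<sigma>\<close>;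
  \<open>unit_T_eq\<close> then gives the shape required by \<open>\<Phi>_transpose\<close>.\<close>

lemma Mlax_eq:
  assumes [simp]: "Y \<in> Obj C'" "Y' \<in> Obj C'"
  defines "X \<equiv> ob P (FqpUQ Y)" and "X' \<equiv> ob P (FqpUQ Y')"
  defines "V \<equiv> ob P (ob Q X \<otimes>\<^bsub>C\<^esub> ob Q X')"
  defines "\<sigma> \<equiv> inv_arr D (\<kappa> X X') \<cdot>\<^bsub>D\<^esub>
    (ar q (ar p (\<gamma> (ob U (ob Q Y)))) \<boxtimes>\<^bsub>D\<^esub> ar q (ar p (\<gamma> (ob U (ob Q Y'))))) \<cdot>\<^bsub>D\<^esub> \<kappa> Y Y'"
  shows "Mlax T Y Y' =
    ar P (\<epsilon> (ob Q V) \<cdot>\<^bsub>C\<^esub> ar F (inv_arr D (b (ob U (ob Q V))) \<cdot>\<^bsub>D\<^esub> ar q (ar p \<sigma>))) \<cdot>\<^bsub>C'\<^esub> \<alpha> V"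
proof -
  have [simp]: "X \<in> Obj C'" "X' \<in> Obj C'" "V \<in> Obj C'"
    by (simp_all add: X_def X'_def V_def)
  \<comment> \<open>Expanding the inverse of \<open>\<kappa>\<close> or merging tensors would
    destroy the form in which \<open>\<sigma>\<close> is stated.\<close>
  note [simp del] = \<kappa>_simps(5) D.interchange
  note [simp] = L.ar_Comp_simp D.P.ar_Comp_simp D.Q.ar_Comp_simp C.P.ar_Comp_simp
  have "lax_U X X' = ar p (\<kappa> X X')" "lax_U Y Y' = ar p (\<kappa> Y Y')"
    by (simp_all add: lax_U_eq)
  then have "Mlax T Y Y' =
    ar P (ar F (ar q (ar p (\<kappa> Y Y')))) \<cdot>\<^bsub>C'\<^esub>
    ar P (ar F (ar q (ar p (ar q (ar p (\<gamma> (ob U (ob Q Y)))) \<boxtimes>\<^bsub>D\<^esub> ar q (ar p (\<gamma> (ob U (ob Q Y')))))))) \<cdot>\<^bsub>C'\<^esub>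
    ar P (ar F (ar q (ar p (inv_arr D (\<kappa> X X'))))) \<cdot>\<^bsub>C'\<^esub> unit_T V"
    by (simp add: right_adjoint_lax_def counit_D_eq D.P.inv_arr_ar X_def[symmetric] X'_def[symmetric]
        V_def[symmetric])
  also have "\<dots> = ar P (\<epsilon> (ob Q V) \<cdot>\<^bsub>C\<^esub> ar F (inv_arr D (b (ob U (ob Q V))) \<cdot>\<^bsub>D\<^esub> ar q (ar p \<sigma>))) \<cdot>\<^bsub>C'\<^esub> \<alpha> V"
    unfolding unit_T_eq[OF \<open>V \<in> Obj C'\<close>] \<sigma>_def by (simp add: V_def X_def X'_def)
  finally show ?thesis .
qed

text \<open>By \<open>\<Phi>_transpose\<close> and naturality of \<open>b\<close>, the image of
  \<open>Mlax\<close> is the arrow \<open>\<sigma>\<close> of \<open>Mlax_eq\<close>. Its last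
  factor \<open>\<kappa> Y Y'\<close> contains the inverse of \<open>m Y Y'\<close>, which cancels,
  and moving \<open>b\<close> past each \<open>\<gamma>\<close> cancels the remaining double
  duals.\<close>

lemma \<Phi>_Mlax:
  assumes [simp]: "Y \<in> Obj C'" "Y' \<in> Obj C'"
  defines "X \<equiv> ob P (FqpUQ Y)" and "X' \<equiv> ob P (FqpUQ Y')"
  defines "V \<equiv> ob P (ob Q X \<otimes>\<^bsub>C\<^esub> ob Q X')" and "W \<equiv> ob P (ob Q Y \<otimes>\<^bsub>C\<^esub> ob Q Y')"
  shows "Mlax T Y Y' \<in> Hom C' V (ob P (FqpUQ W))"
    and "ar \<Phi> (V, Mlax T Y Y', W) \<cdot>\<^bsub>D\<^esub> m Y Y'
      = m X X' \<cdot>\<^bsub>D\<^esub> (\<gamma> (ob U (ob Q Y)) \<boxtimes>\<^bsub>D\<^esub> \<gamma> (ob U (ob Q Y')))"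
proof -
  have [simp]: "X \<in> Obj C'" "X' \<in> Obj C'" "V \<in> Obj C'" "W \<in> Obj C'"
    by (simp_all add: X_def X'_def V_def W_def)
  let ?b = "\<lambda>X. b (ob U (ob Q X))" and ?\<gamma> = "\<lambda>Y. \<gamma> (ob U (ob Q Y))"
  define \<sigma> where "\<sigma> = inv_arr D (\<kappa> X X') \<cdot>\<^bsub>D\<^esub>
    (ar q (ar p (?\<gamma> Y)) \<boxtimes>\<^bsub>D\<^esub> ar q (ar p (?\<gamma> Y'))) \<cdot>\<^bsub>D\<^esub> \<kappa> Y Y'"
  have \<sigma> [simp]: "\<sigma> \<in> Arr D" "Dom D \<sigma> = ob U (ob Q W)" "Cod D \<sigma> = ob U (ob Q V)"
    by (simp_all add: \<sigma>_def V_def W_def X_def X'_def)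
  have Mlax: "Mlax T Y Y' = ar P (\<epsilon> (ob Q V) \<cdot>\<^bsub>C\<^esub> ar F (inv_arr D (?b V) \<cdot>\<^bsub>D\<^esub> ar q (ar p \<sigma>))) \<cdot>\<^bsub>C'\<^esub> \<alpha> V"
    unfolding V_def X_def X'_def \<sigma>_def by (rule Mlax_eq) simp_all
  show "Mlax T Y Y' \<in> Hom C' V (ob P (FqpUQ W))"
    unfolding Mlax in_Hom by simp
  have \<gamma>b: "ar q (ar p (?\<gamma> Z)) \<cdot>\<^bsub>D\<^esub> ?b Z = ?b (ob P (FqpUQ Z)) \<cdot>\<^bsub>D\<^esub> ?\<gamma> Z" if "Z \<in> Obj C'" for Z
    using that D.cohat_iso_natural[of "?\<gamma> Z"] by simp
  have "ar \<Phi> (V, Mlax T Y Y', W) = (inv_arr D (?b V) \<cdot>\<^bsub>D\<^esub> ar q (ar p \<sigma>)) \<cdot>\<^bsub>D\<^esub> ?b W"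
    unfolding Mlax by (rule \<Phi>_transpose) simp_all
  also have "\<dots> = \<sigma>"
    using D.cohat_iso_natural[of \<sigma>] by simp
  finally have "ar \<Phi> (V, Mlax T Y Y', W) \<cdot>\<^bsub>D\<^esub> m Y Y' = \<sigma> \<cdot>\<^bsub>D\<^esub> m Y Y'"
    by simp
  also have "\<dots> = m X X' \<cdot>\<^bsub>D\<^esub> (\<gamma> (ob U (ob Q Y)) \<boxtimes>\<^bsub>D\<^esub> \<gamma> (ob U (ob Q Y')))"
    by (simp add: \<sigma>_def \<kappa>_def[of Y Y'] \<gamma>b X_def X'_def)
  finally show "ar \<Phi> (V, Mlax T Y Y', W) \<cdot>\<^bsub>D\<^esub> m Y Y'
      = m X X' \<cdot>\<^bsub>D\<^esub> (\<gamma> (ob U (ob Q Y)) \<boxtimes>\<^bsub>D\<^esub> \<gamma> (ob U (ob Q Y')))" .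
qed

text \<open>The multiplication is the image of \<open>\<gamma>\<close> by
  \<open>counit_D_eq\<close>, so it merges with \<open>ar (Mfun T) g\<close> into the image of one
  arrow of \<open>D\<close>.\<close>

lemma kleisli_Comp_eq:
  assumes "g \<in> Hom C' Y (ob P (FqpUQ Z))" "Z \<in> Obj C'" "f \<in> Hom C' X (ob P (FqpUQ Y))"
  shows "Mmult T Z \<cdot>\<^bsub>C'\<^esub> ar (Mfun T) g \<cdot>\<^bsub>C'\<^esub> f = ar P (ar F (ar q (ar p (ar \<Phi> (Y, g, Z))))) \<cdot>\<^bsub>C'\<^esub> f"
  using assms
  by (simp add: in_Hom counit_D_eq L.ar_Comp_simp D.P.ar_Comp_simp D.Q.ar_Comp_simp C.P.ar_Comp_simp)

text \<open>The layers of \<open>\<Phi>\<close> are removed in turn: the isomorphism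
  \<open>b\<close>, the adjoint transposition by \<open>transpose_eq\<close>, the isomorphism
  \<open>\<beta>\<close>, and finally \<open>Q\<close>.\<close>

lemma \<Phi>_faithful:
  assumes f: "f \<in> Hom C' X (ob P (FqpUQ Y))" and g: "g \<in> Hom C' X (ob P (FqpUQ Y))"
    and Y [simp]: "Y \<in> Obj C'" and eq: "ar \<Phi> (X, f, Y) = ar \<Phi> (X, g, Y)"
  shows "f = g"
proof -
  let ?V = "ob q (ob p (ob U (ob Q Y)))"
  let ?h = "\<lambda>f. ar Q f \<cdot>\<^bsub>C\<^esub> \<beta> (ob F ?V)"
  have [simp]: "f \<in> Arr C'" "Dom C' f = X" "Cod C' f = ob P (FqpUQ Y)"
    "g \<in> Arr C'" "Dom C' g = X" "Cod C' g = ob P (FqpUQ Y)" "X \<in> Obj C'"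
    using f g C.hat.B.Dom_in by (auto simp: in_Hom)
  have "(ar U (?h f) \<cdot>\<^bsub>D\<^esub> \<eta> ?V) \<cdot>\<^bsub>D\<^esub> b (ob U (ob Q Y)) = (ar U (?h g) \<cdot>\<^bsub>D\<^esub> \<eta> ?V) \<cdot>\<^bsub>D\<^esub> b (ob U (ob Q Y))"
    using eq by (simp add: \<gamma>_def R.ar_Comp_simp)
  then have "ar U (?h f) \<cdot>\<^bsub>D\<^esub> \<eta> ?V = ar U (?h g) \<cdot>\<^bsub>D\<^esub> \<eta> ?V"
    by (rule D.cohat.B.iso_epi[rotated -1]) simp_all
  then have "?h f = ?h g"
    using transpose_eq[of "?h f" ?V] transpose_eq[of "?h g" ?V] by simp
  then have "ar Q f = ar Q g"
    by (rule C.cohat.B.iso_epi[rotated -1]) simp_all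
  then show ?thesis
    by (intro C.Q_faithful) simp_all
qed

lemma \<Phi>_full:
  assumes [simp]: "X \<in> Obj C'" "Y \<in> Obj C'" and v: "v \<in> Hom D (ob U (ob Q Y)) (ob U (ob Q X))"
  shows "\<exists>f \<in> Hom C' X (ob P (FqpUQ Y)). ar \<Phi> (X, f, Y) = v"
proof -
  have [simp]: "v \<in> Arr D" "Dom D v = ob U (ob Q Y)" "Cod D v = ob U (ob Q X)"
    using v by (auto simp: in_Hom)
  \<comment> \<open>Composing with the inverse of \<open>b\<close> brings \<open>v\<close> into the
    form produced by \<open>\<Phi>_transpose\<close>.\<close>
  define w where "w = v \<cdot>\<^bsub>D\<^esub> inv_arr D (b (ob U (ob Q Y)))"
  have w [simp]: "w \<in> Arr D" "Dom D w = ob q (ob p (ob U (ob Q Y)))" "Cod D w = ob U (ob Q X)"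
    by (simp_all add: w_def)
  have "ar \<Phi> (X, ar P (\<epsilon> (ob Q X) \<cdot>\<^bsub>C\<^esub> ar F w) \<cdot>\<^bsub>C'\<^esub> \<alpha> X, Y) = w \<cdot>\<^bsub>D\<^esub> b (ob U (ob Q Y))"
    by (rule \<Phi>_transpose) simp_all
  also have "\<dots> = v"
    by (simp add: w_def)
  finally show ?thesis
    by (intro bexI) (auto simp: in_Hom)
qed

text \<open>The unit object of the Kleisli category is the dual of \<open>\<I>\<close>, so its
  comparison is \<open>e\<close> followed by a double dual isomorphism.\<close>

lemma contravariant_embedding_\<Phi>:
  "contravariant_embedding D (kleisli Ch T) \<Phi> m (ar U (\<beta> \<I>\<^bsub>C\<^esub>) \<cdot>\<^bsub>D\<^esub> e)"
proof
  fix f assume "f \<in> Arr (kleisli Ch T)"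
  then show "Dom (kleisli Ch T) f \<in> Obj (kleisli Ch T)" "Cod (kleisli Ch T) f \<in> Obj (kleisli Ch T)"
    by (cases f; simp)+
next
  fix X assume X: "X \<in> Obj (kleisli Ch T)"
  then show "Ide (kleisli Ch T) X \<in> Hom (kleisli Ch T) X X"
    by (simp add: in_Hom unit_T_eq)
  have "ar \<Phi> (X, unit_T X, X) = inv_arr D (b (ob U (ob Q X))) \<cdot>\<^bsub>D\<^esub> b (ob U (ob Q X))"
    using X unfolding kleisli_simps dual_moncat_simps
    by (subst unit_T_eq, assumption, intro \<Phi>_transpose) simp_all
  then show "ar \<Phi> (Ide (kleisli Ch T) X) = Ide D (ob \<Phi> X)"
    using X by simp
next
  fix t s X Y Z assume "t \<in> Hom (kleisli Ch T) X Y" "s \<in> Hom (kleisli Ch T) Y Z"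
  then obtain f g where t: "t = (X, f, Y)" and s: "s = (Y, g, Z)"
    and XYZ [simp]: "X \<in> Obj C'" "Y \<in> Obj C'" "Z \<in> Obj C'"
    and f: "f \<in> Hom C' X (ob P (FqpUQ Y))" and g: "g \<in> Hom C' Y (ob P (FqpUQ Z))"
    by (auto simp: Hom_kleisli)
  let ?v = "ar \<Phi> (Y, g, Z)"
  have v [simp]: "?v \<in> Arr D" "Dom D ?v = ob U (ob Q Z)" "Cod D ?v = ob U (ob Q Y)"
    using g by (simp_all add: in_Hom)
  have st: "s \<cdot>\<^bsub>kleisli Ch T\<^esub> t = (X, ar P (ar F (ar q (ar p ?v))) \<cdot>\<^bsub>C'\<^esub> f, Z)"
    using kleisli_Comp_eq[OF g XYZ(3) f] unfolding t s by simp
  have v': "ar P (ar F (ar q (ar p ?v))) \<in> Hom C' (ob P (FqpUQ Y)) (ob P (FqpUQ Z))"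
    using v by (simp add: in_Hom del: \<Phi>_simps)
  show "s \<cdot>\<^bsub>kleisli Ch T\<^esub> t \<in> Hom (kleisli Ch T) X Z"
    unfolding st using v' f by (simp add: in_Hom del: \<Phi>_simps)
  have "ar \<Phi> (s \<cdot>\<^bsub>kleisli Ch T\<^esub> t) = ar U (ar Q f) \<cdot>\<^bsub>D\<^esub> ar U (ar Q (ar P (ar F (ar q (ar p ?v))))) \<cdot>\<^bsub>D\<^esub> \<gamma> (ob U (ob Q Z))"
    unfolding st \<Phi>_precompose[OF f v' XYZ(3)] by (simp only: \<Phi>_simps)
  \<comment> \<open>Naturality of \<open>\<gamma>\<close> moves the image of \<open>g\<close> to the
    right, leaving \<open>f\<close> with the \<open>\<gamma>\<close> that completes its own
    image.\<close>
  also have "\<dots> = ar U (ar Q f) \<cdot>\<^bsub>D\<^esub> \<gamma> (ob U (ob Q Y)) \<cdot>\<^bsub>D\<^esub> ?v"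
    using \<gamma>_natural[OF v(1)] unfolding v(2,3) by simp
  also have "\<dots> = ar \<Phi> t \<cdot>\<^bsub>D\<^esub> ar \<Phi> s"
    using f g unfolding t s by (simp add: in_Hom)
  finally show "ar \<Phi> (s \<cdot>\<^bsub>kleisli Ch T\<^esub> t) = ar \<Phi> t \<cdot>\<^bsub>D\<^esub> ar \<Phi> s" .
next
  fix t X Y assume "t \<in> Hom (kleisli Ch T) X Y"
  then show "ar \<Phi> t \<in> Hom D (ob \<Phi> Y) (ob \<Phi> X)"
    unfolding Hom_kleisli by (auto simp: in_Hom)
next
  fix t t' X Y assume "t \<in> Hom (kleisli Ch T) X Y" "t' \<in> Hom (kleisli Ch T) X Y" "ar \<Phi> t = ar \<Phi> t'"
  then show "t = t'"
    by (auto simp only: Hom_kleisli dual_moncat_simps Hom_dual_moncat T_simps intro: \<Phi>_faithful)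
next
  fix X Y h assume "X \<in> Obj (kleisli Ch T)" "Y \<in> Obj (kleisli Ch T)" "h \<in> Hom D (ob \<Phi> Y) (ob \<Phi> X)"
  then obtain f where "X \<in> Obj C'" "Y \<in> Obj C'" "f \<in> Hom C' X (ob P (FqpUQ Y))" "ar \<Phi> (X, f, Y) = h"
    using \<Phi>_full[of X Y h] by auto
  then show "\<exists>t \<in> Hom (kleisli Ch T) X Y. ar \<Phi> t = h"
    by (intro bexI[of _ "(X, f, Y)"]) (auto simp: in_Hom)
next
  fix t t' X Y X' Y' assume "t \<in> Hom (kleisli Ch T) X Y" "t' \<in> Hom (kleisli Ch T) X' Y'"
  then obtain f f' where t: "t = (X, f, Y)" and t': "t' = (X', f', Y')"
    and XY [simp]: "X \<in> Obj C'" "Y \<in> Obj C'" "X' \<in> Obj C'" "Y' \<in> Obj C'"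
    and f: "f \<in> Hom C' X (ob P (FqpUQ Y))" and f': "f' \<in> Hom C' X' (ob P (FqpUQ Y'))"
    by (auto simp: Hom_kleisli)
  \<comment> \<open>The Kleisli tensor is \<open>Mlax\<close> after \<open>?g\<close>, the tensor of
    \<open>f\<close> and \<open>f'\<close> in the dual structure; \<open>m_natural\<close> handles
    \<open>?g\<close> and \<open>\<Phi>_Mlax\<close> handles \<open>Mlax\<close>.\<close>
  let ?g = "ar P (ar Q f \<boxtimes>\<^bsub>C\<^esub> ar Q f')" and ?W = "ob P (ob Q Y \<otimes>\<^bsub>C\<^esub> ob Q Y')"
    and ?V = "ob P (ob Q (ob P (FqpUQ Y)) \<otimes>\<^bsub>C\<^esub> ob Q (ob P (FqpUQ Y')))"
  have g: "?g \<in> Hom C' (ob P (ob Q X \<otimes>\<^bsub>C\<^esub> ob Q X')) ?V"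
    using f f' by (simp add: in_Hom)
  have W: "?W \<in> Obj C'" by simp
  note Mlax = \<Phi>_Mlax[OF XY(2,4)]
  have tt': "t \<boxtimes>\<^bsub>kleisli Ch T\<^esub> t' = (ob P (ob Q X \<otimes>\<^bsub>C\<^esub> ob Q X'), Mlax T Y Y' \<cdot>\<^bsub>C'\<^esub> ?g, ?W)"
    unfolding t t' by simp
  show "t \<boxtimes>\<^bsub>kleisli Ch T\<^esub> t' \<in> Hom (kleisli Ch T) (X \<otimes>\<^bsub>kleisli Ch T\<^esub> X') (Y \<otimes>\<^bsub>kleisli Ch T\<^esub> Y')"
    unfolding tt' using Mlax(1) g by (simp add: in_Hom del: T_simps(5))
  have "ar \<Phi> (t \<boxtimes>\<^bsub>kleisli Ch T\<^esub> t') \<cdot>\<^bsub>D\<^esub> m Y Y'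
    = ar U (ar Q ?g) \<cdot>\<^bsub>D\<^esub> ar \<Phi> (?V, Mlax T Y Y', ?W) \<cdot>\<^bsub>D\<^esub> m Y Y'"
    unfolding tt' \<Phi>_precompose[OF g Mlax(1) W] using g Mlax(1)
    by (simp add: in_Hom del: T_simps(5))
  also have "\<dots> = (ar U (ar Q ?g) \<cdot>\<^bsub>D\<^esub> m (ob P (FqpUQ Y)) (ob P (FqpUQ Y')))
    \<cdot>\<^bsub>D\<^esub> (\<gamma> (ob U (ob Q Y)) \<boxtimes>\<^bsub>D\<^esub> \<gamma> (ob U (ob Q Y')))"
    unfolding Mlax(2) using f f' by (simp add: in_Hom)
  also have "\<dots> = m X X' \<cdot>\<^bsub>D\<^esub> (ar \<Phi> t \<boxtimes>\<^bsub>D\<^esub> ar \<Phi> t')"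
    unfolding m_natural[OF f f'] t t' using f f' by (simp add: in_Hom)
  finally show "ar \<Phi> (t \<boxtimes>\<^bsub>kleisli Ch T\<^esub> t') \<cdot>\<^bsub>D\<^esub> m Y Y' = m X X' \<cdot>\<^bsub>D\<^esub> (ar \<Phi> t \<boxtimes>\<^bsub>D\<^esub> ar \<Phi> t')" .
next
  show "ar U (\<beta> \<I>\<^bsub>C\<^esub>) \<cdot>\<^bsub>D\<^esub> e \<in> Hom D \<I>\<^bsub>D\<^esub> (ob \<Phi> \<I>\<^bsub>kleisli Ch T\<^esub>)"
    "iso D (ar U (\<beta> \<I>\<^bsub>C\<^esub>) \<cdot>\<^bsub>D\<^esub> e)"
    using U.e_in U.e_iso by (auto simp: in_Hom R.iso_ar intro!: D.cohat.B.iso_Comp)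
qed (auto simp: in_Hom)

theorem dually_equivalent_Op:
  "dually_equivalent (Op k n C D U) (Op n k Ch (kleisli Ch T) (kleisli_J Ch T))"
proof -
  interpret K: contravariant_embedding D "kleisli Ch T" \<Phi> m "ar U (\<beta> \<I>\<^bsub>C\<^esub>) \<cdot>\<^bsub>D\<^esub> e"
    by (rule contravariant_embedding_\<Phi>)
  show ?thesis
  proof (rule K.dually_equivalent_Op)
    fix Z assume "Z \<in> Obj C"
    then show "\<exists>X \<in> Obj (kleisli Ch T). \<exists>i \<in> Hom C Z (ob Q X). iso C i"
      \<comment> \<open>Every \<open>Z\<close> is reached from its dual \<open>ob P Z\<close>
        through the double dual isomorphism \<open>\<beta> Z\<close>.\<close>
      by (intro bexI[of _ "ob P Z"] bexI[of _ "\<beta> Z"]) (auto simp: in_Hom)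
  qed (auto simp: R.is_functor_axioms kleisli_J_def)
qed

end

theorem theorem3p8:
  fixes C :: "('oc, 'ac) moncat" and D :: "('od, 'ad) moncat"
    and C' :: "('oc1, 'ac1) cat" and D' :: "('od1, 'ad1) cat"
    and dC :: "('oc, 'ac, 'oc1, 'ac1) dual_data" and dD :: "('od, 'ad, 'od1, 'ad1) dual_data"
    and F :: "('od, 'ad, 'oc, 'ac) fun_data" and U :: "('oc, 'ac, 'od, 'ad) fun_data"
    and \<eta> :: "'od \<Rightarrow> 'ad" and \<epsilon> :: "'oc \<Rightarrow> 'ac"
    and l :: "'oc \<Rightarrow> 'oc \<Rightarrow> 'ad" and e :: 'ad
    and k n :: nat
  assumes "strict_monoidal C" and "strict_monoidal D"
    and "dual_adjoint_equivalence C C' dC"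
    and "dual_adjoint_equivalence D D' dD"
    and "adjunction D C F U \<eta> \<epsilon>"
    and "strong_monoidal_functor C D U l e"
  shows "let Ch = dual_moncat C C' dC;
             Dh = dual_moncat D D' dD;
             Uh = dual_functor dC dD U;
             Fh = dual_functor dD dC F;
             T = adjunction_monad Ch Dh Uh Fh
                   (dual_counit C D C' dC dD F U \<epsilon>)
                   (dual_unit D' dC dD F U \<eta>)
                   (dual_laxator C D D' dC dD U l)
         in dually_equivalent (Op k n C D U) (Op n k Ch (kleisli Ch T) (kleisli_J Ch T))"
proof -
  interpret dual_monoidal_adjunction C D C' D' dC dD F U \<eta> \<epsilon> l e
    using assms by (intro dual_monoidal_adjunction.intro)
  show ?thesis
    unfolding Let_def by (rule dually_equivalent_Op)
qed

end
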